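(* Consider the setting where the set of alternatives equals the set $C$ of $n$ agents. The mechanism Boruvka defined in the context (which computes $n$ times the cost of a minimum-cost $k$-forest on $C$, and does not depend on $\ell$) has $O(\log n)$ per-agent query complexity and returns an estimate $B$ such that $\mathrm{OPT}\le B\le n^2\cdot\mathrm{OPT}$, where $\mathrm{OPT}=\mathrm{OPT}_\ell$ is the optimal $\ell$-centrum value.
   Context: Setting. $C$ is a finite set of $n$ agents, which is also the set of alternatives; $1\le k,\ell\le n$. There is an unknown underlying metric $d$ on $C$ (symmetric, nonnegative, $d(i,i)=0$, triangle inequality; distinct points may be co-located). The preference profile $\sigma=(\succeq_i)_{i\in C}$ consists of total orders on $C$ consistent with $d$: $a\succeq_i b$ implies $d(i,a)\le d(i,b)$. For $S\subseteq C$ nonempty, $d(i,S)=\min_{a\in S}d(i,a)$ and $d(C,S)=(d(i,S))_{i\in C}$. $\mathrm{Top}_\ell(v)$ is the sum of the $\ell$ largest entries of $v$. The $\ell$-centrum problem asks for $S\subseteq C$, $|S|\le k$, minimizing $\mathrm{Top}_\ell(d(C,S))$; its optimal value is $\mathrm{OPT}_\ell$. Queries. A mechanism is given $\sigma$ but not $d$; it may adaptively make value queries, where a value query to agent $i$ about alternative $a$ returns $d(i,a)$. Its per-agent query complexity is the maximum number of queries made to any single agent. Mechanism Boruvka. Edges are the pairs $\{i,j\}\subseteq C$, with cost $d(i,j)$. For a set $S\subseteq C$, $\delta(S)$ is the set of edges with exactly one endpoint in $S$, and $\delta(v)=\delta(\{v\})$. 1. Fix a tie-breaking rule on the edges, used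 in all edge-cost comparisons. Set $F=\emptyset$, $V_1=C$ (each agent is a singleton supernode), $E_1$ the set of all edges, $t=1$. 2. While $|V_t|>1$: for each supernode $S\in V_t$, query for each $v\in S$ the value $\min_{e\in\delta(v)\cap\delta(S)}d(e)$ (the minimizing edge is known from $\succeq_v$, so this is one value query to $v$), and add to $F$ the cheapest edge of $\delta(S)$. Then contract the components of the graph $(V_t,F\cap E_t)$ into supernodes to obtain the multigraph $(V_{t+1},E_{t+1})$, and increase $t$ by 1. 3. Remove edges from $F$ in non-increasing order of cost until $F$ has exactly $k$ components. 4. Return $B=n\cdot\sum_{e\in F}d(e)$.
   Formalization: Agents may break ties differently from the fixed edge rule, so the rule-cheapest edge of δ(S) may be unknowable; the "cheapest edge of δ(S)" is therefore chosen by cost, then rule, among all edges of δ(S) whose cost has been learned so far, by a query to either endpoint. *)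

theory Defs
  imports Complex_Main "HOL-Library.Multiset" "HOL-Library.Landau_Symbols"
    "HOL-Library.While_Combinator"
begin

section \<open>Agents, metric and preferences\<close>

text \<open>Distinct agents may be at distance 0, so the library's metric spaces do not apply.\<close>

definition metric_on :: "'a set \<Rightarrow> ('a \<Rightarrow> 'a \<Rightarrow> real) \<Rightarrow> bool" where
  "metric_on C d \<longleftrightarrow>
     (\<forall>i\<in>C. d i i = 0) \<and>
     (\<forall>i\<in>C. \<forall>j\<in>C. 0 \<le> d i j \<and> d i j = d j i) \<and>
     (\<forall>i\<in>C. \<forall>j\<in>C. \<forall>h\<in>C. d i h \<le> d i j + d j h)"

text \<open>\<open>(a, b) \<in> \<sigma> i\<close> means that agent \<open>i\<close> weakly prefers \<open>a\<close> to \<open>b\<close>.\<close>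

definition profile_on :: "'a set \<Rightarrow> ('a \<Rightarrow> 'a rel) \<Rightarrow> bool" where
  "profile_on C \<sigma> \<longleftrightarrow> (\<forall>i\<in>C. linear_order_on C (\<sigma> i))"

definition consistent :: "'a set \<Rightarrow> ('a \<Rightarrow> 'a \<Rightarrow> real) \<Rightarrow> ('a \<Rightarrow> 'a rel) \<Rightarrow> bool" where
  "consistent C d \<sigma> \<longleftrightarrow> (\<forall>i\<in>C. \<forall>a\<in>C. \<forall>b\<in>C. (a, b) \<in> \<sigma> i \<longrightarrow> d i a \<le> d i b)"


section \<open>The centrum problem\<close>

definition dist_to_set :: "('a \<Rightarrow> 'a \<Rightarrow> real) \<Rightarrow> 'a \<Rightarrow> 'a set \<Rightarrow> real" where
  "dist_to_set d i S = Min (d i ` S)"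

definition Top :: "nat \<Rightarrow> 'a set \<Rightarrow> ('a \<Rightarrow> real) \<Rightarrow> real" where
  "Top l C v = sum_list (take l (rev (sorted_list_of_multiset (image_mset v (mset_set C)))))"

definition OPT :: "'a set \<Rightarrow> ('a \<Rightarrow> 'a \<Rightarrow> real) \<Rightarrow> nat \<Rightarrow> nat \<Rightarrow> real" where
  "OPT C d k l =
     Min {Top l C (\<lambda>i. dist_to_set d i S) | S. S \<subseteq> C \<and> S \<noteq> {} \<and> card S \<le> k}"


section \<open>Mechanisms with value queries\<close>

text \<open>A mechanism interacts with the metric in steps. In state \<open>s\<close> it makes the value queries
  \<open>ask s\<close>, where \<open>(i, a)\<close> is the query to agent \<open>i\<close> about alternative \<open>a\<close>; it then receives
  the answers to these queries and nothing else, and moves to a new state. The metric is not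
  otherwise accessible to it.\<close>

record ('a, 's) mechanism =
  start :: 's
  halted :: "'s \<Rightarrow> bool"
  ask :: "'s \<Rightarrow> ('a \<times> 'a) set"
  learn :: "'s \<Rightarrow> ('a \<times> 'a \<rightharpoonup> real) \<Rightarrow> 's"
  estimate :: "'s \<Rightarrow> real"

definition answers :: "('a \<Rightarrow> 'a \<Rightarrow> real) \<Rightarrow> ('a \<times> 'a) set \<Rightarrow> ('a \<times> 'a \<rightharpoonup> real)" where
  "answers d Q = (\<lambda>(i, a). if (i, a) \<in> Q then Some (d i a) else None)"

text \<open>The result is \<open>None\<close> if the mechanism does not halt, and otherwise its estimate together
  with the list of the query sets of all steps. A query that is repeated in a later step occurs
  again in this list.\<close>

definition execute ::
  "('a, 's) mechanism \<Rightarrow> ('a \<Rightarrow> 'a \<Rightarrow> real) \<Rightarrow> (real \<times> ('a \<times> 'a) set list) option" where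
  "execute M d =
     map_option (\<lambda>(s, qs). (estimate M s, qs))
       (while_option (\<lambda>(s, qs). \<not> halted M s)
          (\<lambda>(s, qs). (learn M s (answers d (ask M s)), qs @ [ask M s]))
          (start M, []))"

definition per_agent_queries :: "'a set \<Rightarrow> ('a \<times> 'a) set list \<Rightarrow> nat" where
  "per_agent_queries C qs = Max ((\<lambda>i. \<Sum>Q\<leftarrow>qs. card {a. (i, a) \<in> Q}) ` C)"


section \<open>Graphs on the agents\<close>

definition edges :: "'a set \<Rightarrow> 'a set set" where
  "edges C = {{i, j} | i j. i \<in> C \<and> j \<in> C \<and> i \<noteq> j}"

definition cut :: "'a set \<Rightarrow> 'a set \<Rightarrow> 'a set set" where
  "cut C S = {e \<in> edges C. card (e \<inter> S) = 1}"

definition connected_by :: "'a set set \<Rightarrow> 'a rel" where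
  "connected_by F = {(i, j). {i, j} \<in> F}\<^sup>*"

definition num_components :: "'a set \<Rightarrow> 'a set set \<Rightarrow> nat" where
  "num_components C F = card (C // connected_by F)"

definition edge_cost :: "('a \<Rightarrow> 'a \<Rightarrow> real) \<Rightarrow> 'a set \<Rightarrow> real" where
  "edge_cost d e = (THE x. \<exists>i j. e = {i, j} \<and> x = d i j)"

text \<open>Acyclicity: no edge has its endpoints connected by the other edges.\<close>

definition k_forest :: "'a set \<Rightarrow> nat \<Rightarrow> 'a set set \<Rightarrow> bool" where
  "k_forest C k F \<longleftrightarrow>
     F \<subseteq> edges C \<and>
     (\<forall>i j. {i, j} \<in> F \<longrightarrow> (i, j) \<notin> connected_by (F - {{i, j}})) \<and>
     num_components C F = k"

definition min_k_forest_cost :: "'a set \<Rightarrow> ('a \<Rightarrow> 'a \<Rightarrow> real) \<Rightarrow> nat \<Rightarrow> real" where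
  "min_k_forest_cost C d k = Min {\<Sum>e\<in>F. edge_cost d e | F. k_forest C k F}"

text \<open>The multigraph on a partition \<open>V\<close> of the agents is represented by the original edges
  that join different members of \<open>V\<close>.\<close>

definition crossing :: "'a set \<Rightarrow> 'a set set \<Rightarrow> 'a set set" where
  "crossing C V = {e \<in> edges C. \<not> (\<exists>S\<in>V. e \<subseteq> S)}"

definition contract :: "'a set set \<Rightarrow> 'a set set \<Rightarrow> 'a set set" where
  "contract V E =
     Union ` (V // {(S, T). S \<in> V \<and> T \<in> V \<and> (\<exists>i\<in>S. \<exists>j\<in>T. {i, j} \<in> E)}\<^sup>*)"


section \<open>The mechanism Boruvka\<close>

definition favourite :: "('a \<Rightarrow> 'a rel) \<Rightarrow> 'a \<Rightarrow> 'a set \<Rightarrow> 'a" where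
  "favourite \<sigma> v A = (THE a. a \<in> A \<and> (\<forall>b\<in>A. (a, b) \<in> \<sigma> v))"

definition known_edges :: "('a \<times> 'a \<rightharpoonup> real) \<Rightarrow> 'a set set" where
  "known_edges m = {{i, a} | i a. (i, a) \<in> dom m}"

definition known_cost :: "('a \<times> 'a \<rightharpoonup> real) \<Rightarrow> 'a set \<Rightarrow> real" where
  "known_cost m e = (THE x. \<exists>i a. e = {i, a} \<and> m (i, a) = Some x)"

text \<open>A tie-breaking rule is a linear order on the edges; it decides between edges of equal
  cost.\<close>

definition no_dearer :: "'a set rel \<Rightarrow> ('a \<times> 'a \<rightharpoonup> real) \<Rightarrow> 'a set \<Rightarrow> 'a set \<Rightarrow> bool" where
  "no_dearer tie m e f \<longleftrightarrow>
     known_cost m e < known_cost m f \<or> (known_cost m e = known_cost m f \<and> (e, f) \<in> tie)"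

definition cheapest :: "'a set rel \<Rightarrow> ('a \<times> 'a \<rightharpoonup> real) \<Rightarrow> 'a set set \<Rightarrow> 'a set" where
  "cheapest tie m A = (THE e. e \<in> A \<and> (\<forall>f\<in>A. no_dearer tie m e f))"

definition dearest :: "'a set rel \<Rightarrow> ('a \<times> 'a \<rightharpoonup> real) \<Rightarrow> 'a set set \<Rightarrow> 'a set" where
  "dearest tie m A = (THE e. e \<in> A \<and> (\<forall>f\<in>A. no_dearer tie m f e))"

record 'a boruvka_state =
  supernodes :: "'a set set"
  chosen :: "'a set set"
  info :: "'a \<times> 'a \<rightharpoonup> real"  \<comment> \<open>all answers received so far\<close>

text \<open>For \<open>v \<in> S\<close>, the members of \<open>\<delta>(v) \<inter> \<delta>(S)\<close> are the pairs of \<open>v\<close> with an agent outside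
  \<open>S\<close>, so the cost of a cheapest one is the distance from \<open>v\<close> to its favourite agent
  outside \<open>S\<close>.\<close>

definition boruvka_ask ::
  "'a set \<Rightarrow> ('a \<Rightarrow> 'a rel) \<Rightarrow> 'a boruvka_state \<Rightarrow> ('a \<times> 'a) set" where
  "boruvka_ask C \<sigma> s = {(v, favourite \<sigma> v (C - S)) | v S. S \<in> supernodes s \<and> v \<in> S}"

text \<open>The preference of an agent need not resolve ties as the tie-breaking rule does, and from
  the preferences and the answers one cannot tell whether an edge of unknown cost is tied with
  a cheapest edge. The tie-breaking rule is therefore applied to the edges of the cut of \<open>S\<close>
  whose cost is known, whichever endpoint reported it. One of them attains the minimum cost
  over the whole cut, so the selected edge is a cheapest edge of the cut; and as all supernodes
  consult the same known costs, the selected edges close no cycle.\<close>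

definition boruvka_learn ::
  "'a set \<Rightarrow> 'a set rel \<Rightarrow> 'a boruvka_state \<Rightarrow> ('a \<times> 'a \<rightharpoonup> real) \<Rightarrow> 'a boruvka_state" where
  "boruvka_learn C tie s ans =
     (let V = supernodes s;
          m = info s ++ ans;
          F = chosen s \<union> {cheapest tie m (cut C S \<inter> known_edges m) | S. S \<in> V}
      in \<lparr>supernodes = contract V (F \<inter> crossing C V), chosen = F, info = m\<rparr>)"

definition prune ::
  "'a set \<Rightarrow> nat \<Rightarrow> 'a set rel \<Rightarrow> ('a \<times> 'a \<rightharpoonup> real) \<Rightarrow> 'a set set \<Rightarrow> 'a set set" where
  "prune C k tie m = while (\<lambda>F. num_components C F \<noteq> k) (\<lambda>F. F - {dearest tie m F})"

definition boruvka ::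
  "'a set \<Rightarrow> nat \<Rightarrow> 'a set rel \<Rightarrow> ('a \<Rightarrow> 'a rel) \<Rightarrow> ('a, 'a boruvka_state) mechanism" where
  "boruvka C k tie \<sigma> =
     \<lparr>start = \<lparr>supernodes = {{i} | i. i \<in> C}, chosen = {}, info = Map.empty\<rparr>,
      halted = (\<lambda>s. \<not> card (supernodes s) > 1),
      ask = boruvka_ask C \<sigma>,
      learn = boruvka_learn C tie,
      estimate = (\<lambda>s. real (card C) *
        (\<Sum>e\<in>prune C k tie (info s) (chosen s). known_cost (info s) e))\<rparr>"

end

theory Submission
  imports Defs
begin

text \<open>Every supernode is a component of the forest \<open>F\<close> chosen so far, and every edge of \<open>F\<close> is
  cheapest in a cut that contains no edge of \<open>F\<close> preceding it in the order by cost, then round,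
  then tie-breaking rule. Removing the edges of \<open>F\<close> from the last one in this order shows that
  \<open>F\<close> is acyclic and that any two connected agents \<open>i\<close> and \<open>j\<close> are connected by edges of cost at most
  \<open>d i j\<close>. Hence for every \<open>c\<close> no forest has more edges of cost at most \<open>c\<close> than the final \<open>F\<close>, so
  that its \<open>n - k\<close> cheapest edges form a minimum-cost \<open>k\<close>-forest. Each round at least halves the
  number of supernodes and makes one query per agent.

  For the estimate, one representative per tree is a feasible solution in which every agent is
  within the total cost of the forest, and conversely joining every agent to a nearest member of
  an optimal solution gives a forest whose cost is at most \<open>n\<close> times the optimum.\<close>

section \<open>Least elements, linear orders and comparison of sums\<close>

text \<open>Supplies the unique existence behind the definite descriptions \<open>cheapest\<close>,
  \<open>dearest\<close> and \<open>favourite\<close>. \<open>R\<close> is an abstract predicate so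
  that reversed orders and orders by cost with tie-breaking can be inserted.\<close>

lemma finite_least:
  assumes "finite A" "A \<noteq> {}"
    and total: "\<And>x y. x \<in> A \<Longrightarrow> y \<in> A \<Longrightarrow> R x y \<or> R y x"
    and trans: "\<And>x y z. x \<in> A \<Longrightarrow> y \<in> A \<Longrightarrow> z \<in> A \<Longrightarrow> R x y \<Longrightarrow> R y z \<Longrightarrow> R x z"
    and antisym: "\<And>x y. x \<in> A \<Longrightarrow> y \<in> A \<Longrightarrow> R x y \<Longrightarrow> R y x \<Longrightarrow> x = y"
  shows "\<exists>!a. a \<in> A \<and> (\<forall>b\<in>A. R a b)"
proof -
  have "\<exists>a\<in>B. \<forall>b\<in>B. R a b" if "finite B" "B \<noteq> {}" "B \<subseteq> A" for B
    using that
  proof (induction rule: finite_ne_induct)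
    case (singleton x)
    then show ?case using total by auto
  next
    case (insert x B)
    then obtain a where a: "a \<in> B" "\<forall>b\<in>B. R a b" by auto
    show ?case
    proof (cases "R a x")
      case True
      with a show ?thesis by blast
    next
      case False
      with a insert.prems total have "R x a" by blast
      with a insert.prems have "\<forall>b\<in>B. R x b"
        using trans by (meson insert_subset subsetD)
      with total insert.prems show ?thesis by blast
    qed
  qed
  from this[OF assms(1,2) order_refl] obtain a where "a \<in> A" "\<forall>b\<in>A. R a b" by auto
  with antisym show ?thesis by (intro ex1I[of _ a]) auto
qed

lemma linear_order_onE:
  assumes "linear_order_on A r"
  shows "\<And>x y. x \<in> A \<Longrightarrow> y \<in> A \<Longrightarrow> (x, y) \<in> r \<or> (y, x) \<in> r"
    and "\<And>x y z. (x, y) \<in> r \<Longrightarrow> (y, z) \<in> r \<Longrightarrow> (x, z) \<in> r"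
    and "\<And>x y. (x, y) \<in> r \<Longrightarrow> (y, x) \<in> r \<Longrightarrow> x = y"
proof -
  show "(x, y) \<in> r \<or> (y, x) \<in> r" if "x \<in> A" "y \<in> A" for x y
    using assms that unfolding order_on_defs total_on_def refl_on_def by metis
  show "(x, z) \<in> r" if "(x, y) \<in> r" "(y, z) \<in> r" for x y z
    using assms that unfolding order_on_defs by (blast dest: transD)
  show "x = y" if "(x, y) \<in> r" "(y, x) \<in> r" for x y
    using assms that unfolding order_on_defs by (blast dest: antisymD)
qed

text \<open>A largest \<open>u a\<close> is at most a largest \<open>w b\<close>: with threshold
  \<open>w b\<close> all of \<open>B\<close> is counted, hence all of \<open>A\<close>. Removing
  both elements preserves the condition on counts, so induction pairs off the values in decreasing
  order.\<close>

lemma sum_le_if_counts_le: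
  fixes u :: "'b \<Rightarrow> real" and w :: "'c \<Rightarrow> real"
  assumes "finite A" "finite B" "card A = card B"
    and "\<And>c. card {b \<in> B. w b \<le> c} \<le> card {a \<in> A. u a \<le> c}"
  shows "sum u A \<le> sum w B"
  using assms
proof (induction "card A" arbitrary: A B)
  case 0
  then show ?case by simp
next
  case (Suc n)
  then have ne: "A \<noteq> {}" "B \<noteq> {}" by auto
  obtain a where a: "a \<in> A" "\<And>x. x \<in> A \<Longrightarrow> u x \<le> u a"
    using Max_in[of "u ` A"] Max_ge[of "u ` A"] Suc.prems(1) ne by fastforce
  obtain b where b: "b \<in> B" "\<And>x. x \<in> B \<Longrightarrow> w x \<le> w b"
    using Max_in[of "w ` B"] Max_ge[of "w ` B"] Suc.prems(2) ne by fastforce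
  have "{x \<in> B. w x \<le> w b} = B" using b by auto
  with Suc.prems(4)[of "w b"] Suc.prems(3) have "card A \<le> card {x \<in> A. u x \<le> w b}" by simp
  with Suc.prems(1) have "{x \<in> A. u x \<le> w b} = A"
    by (intro card_seteq) auto
  with a have ab: "u a \<le> w b" by auto
  have "sum u (A - {a}) \<le> sum w (B - {b})"
  proof (rule Suc.hyps(1))
    show "n = card (A - {a})" "card (A - {a}) = card (B - {b})" "finite (A - {a})" "finite (B - {b})"
      using Suc a b by auto
    \<comment> \<open>If \<open>c\<close> is at least \<open>u a\<close>, every remaining element of
      \<open>A\<close> is counted and the cardinalities agree; otherwise \<open>a\<close> was not
      counted before its removal.\<close>
    show "card {x \<in> B - {b}. w x \<le> c} \<le> card {x \<in> A - {a}. u x \<le> c}" for c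
    proof (cases "u a \<le> c")
      case True
      then have "{x \<in> A - {a}. u x \<le> c} = A - {a}" using a by force
      moreover have "card {x \<in> B - {b}. w x \<le> c} \<le> card (B - {b})"
        using Suc.prems(2) by (intro card_mono) auto
      ultimately show ?thesis using Suc.prems a b by auto
    next
      case False
      then have "{x \<in> A - {a}. u x \<le> c} = {x \<in> A. u x \<le> c}" by auto
      moreover have "card {x \<in> B - {b}. w x \<le> c} \<le> card {x \<in> B. w x \<le> c}"
        using Suc.prems(2) by (intro card_mono) auto
      ultimately show ?thesis using Suc.prems(4)[of c] by auto
    qed
  qed
  with ab show ?case
    using Suc.prems(1,2) a b by (simp add: sum.remove[of A a] sum.remove[of B b])
qed


section \<open>Connectivity\<close>

lemma connected_by_refl [simp]: "(i, i) \<in> connected_by F"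
  by (simp add: connected_by_def)

lemma connected_by_edge: "{i, j} \<in> F \<Longrightarrow> (i, j) \<in> connected_by F"
  by (auto simp: connected_by_def)

lemma connected_by_mono: "F \<subseteq> G \<Longrightarrow> connected_by F \<subseteq> connected_by G"
  unfolding connected_by_def by (intro rtrancl_mono) auto

lemma connected_by_trans:
  "(i, j) \<in> connected_by F \<Longrightarrow> (j, h) \<in> connected_by F \<Longrightarrow> (i, h) \<in> connected_by F"
  unfolding connected_by_def by (rule rtrancl_trans)

lemma connected_by_sym: "(i, j) \<in> connected_by F \<Longrightarrow> (j, i) \<in> connected_by F"
proof -
  have "sym {(i, j). {i, j} \<in> F}" by (auto simp: sym_def insert_commute)
  then show "(i, j) \<in> connected_by F \<Longrightarrow> (j, i) \<in> connected_by F"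
    unfolding connected_by_def by (blast dest: sym_rtrancl symD)
qed

lemma equiv_connected_by: "equiv UNIV (connected_by F)"
  by (intro equivI refl_onI symI transI)
    (auto elim: connected_by_sym dest: connected_by_trans)

text \<open>A walk never has to cross the new edge more than once: after a second crossing it is
  back at an endpoint that it had already visited.\<close>

lemma connected_by_insert:
  "(x, y) \<in> connected_by (insert {a, b} F) \<longleftrightarrow>
     (x, y) \<in> connected_by F \<or>
     (x, a) \<in> connected_by F \<and> (b, y) \<in> connected_by F \<or>
     (x, b) \<in> connected_by F \<and> (a, y) \<in> connected_by F" (is "?L = ?R")
proof
  assume ?L
  then show ?R
    unfolding connected_by_def[of "insert {a, b} F"]
  proof (induction rule: rtrancl_induct)
    case base
    then show ?case by simp
  next
    case (step y z)
    from step(2) consider "{y, z} \<in> F" | "y = a" "z = b" | "y = b" "z = a"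
      by (auto simp: doubleton_eq_iff)
    then show ?case
    proof cases
      case 1
      then show ?thesis using step.IH connected_by_edge connected_by_trans by metis
    next
      case 2
      then show ?thesis using step.IH by auto
    next
      case 3
      then show ?thesis using step.IH by auto
    qed
  qed
next
  have "(a, b) \<in> connected_by (insert {a, b} F)" "(b, a) \<in> connected_by (insert {a, b} F)"
    by (auto intro: connected_by_edge simp: insert_commute)
  moreover have "connected_by F \<subseteq> connected_by (insert {a, b} F)"
    by (intro connected_by_mono) auto
  moreover assume ?R
  ultimately show ?L
    by (elim disjE conjE) (blast intro: connected_by_trans)+
qed

text \<open>Invariance along single edges extends to walks. The instances of \<open>P\<close> are
  membership in \<open>C\<close>, membership in one side of a cut, and equality with a fixed
  agent.\<close>

lemma connected_by_cong:
  assumes "(x, y) \<in> connected_by F" "\<And>i j. {i, j} \<in> F \<Longrightarrow> P i \<longleftrightarrow> P j"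
  shows "P x \<longleftrightarrow> P y"
  using assms(1) unfolding connected_by_def
  by (induction rule: rtrancl_induct) (use assms(2) in auto)

section \<open>Edges and cuts\<close>

lemma edge_endpoints: "F \<subseteq> edges C \<Longrightarrow> {i, j} \<in> F \<Longrightarrow> i \<in> C \<and> j \<in> C \<and> i \<noteq> j"
  unfolding edges_def by (fastforce simp: doubleton_eq_iff)

lemma edge_in_edges [simp]: "{i, j} \<in> edges C \<longleftrightarrow> i \<in> C \<and> j \<in> C \<and> i \<noteq> j"
  using edge_endpoints[OF order_refl, of i j C] unfolding edges_def by blast

lemma edgesE:
  assumes "e \<in> edges C"
  obtains i j where "e = {i, j}" "i \<in> C" "j \<in> C" "i \<noteq> j"
  using assms by (auto simp: edges_def)

lemma finite_edges: "finite C \<Longrightarrow> finite (edges C)"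
  by (rule finite_subset[of _ "Pow C"]) (auto simp: edges_def)

lemma edge_in_cut [simp]: "{i, j} \<in> cut C S \<longleftrightarrow> i \<in> C \<and> j \<in> C \<and> (i \<in> S \<longleftrightarrow> j \<notin> S)"
proof -
  have "card ({i, j} \<inter> S) = 1 \<longleftrightarrow> (i \<in> S \<longleftrightarrow> j \<notin> S)" if "i \<noteq> j"
    using that by (cases "i \<in> S"; cases "j \<in> S") auto
  then show ?thesis by (auto simp: cut_def)
qed

lemma cut_subset_edges: "cut C S \<subseteq> edges C"
  by (auto simp: cut_def)

lemma cutE:
  assumes "e \<in> cut C S"
  obtains i j where "e = {i, j}" "i \<in> C" "j \<in> C" "i \<in> S" "j \<notin> S"
proof -
  from assms have "e \<in> edges C" by (simp add: cut_def)
  then obtain i j where e: "e = {i, j}" "i \<in> C" "j \<in> C" by (elim edgesE)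
  with assms have "i \<in> S \<longleftrightarrow> j \<notin> S" by simp
  with e that[of i j] that[of j i] show ?thesis by (auto simp only: insert_commute)
qed

lemma connected_by_closed:
  assumes "F \<subseteq> edges C" "(i, j) \<in> connected_by F"
  shows "i \<in> C \<longleftrightarrow> j \<in> C"
  using connected_by_cong[OF assms(2), of "\<lambda>x. x \<in> C"] edge_endpoints[OF assms(1)] by blast

lemma connected_by_not_cut:
  assumes "F \<subseteq> edges C" "F \<inter> cut C S = {}" "(i, j) \<in> connected_by F"
  shows "i \<in> S \<longleftrightarrow> j \<in> S"
proof (rule connected_by_cong[OF assms(3), where P = "\<lambda>x. x \<in> S"])
  fix i j assume "{i, j} \<in> F"
  with assms(2) have "{i, j} \<notin> cut C S" by blast
  with \<open>{i, j} \<in> F\<close> show "i \<in> S \<longleftrightarrow> j \<in> S" using edge_endpoints[OF assms(1)] by simp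
qed

section \<open>Number of components\<close>

lemma component_eq_iff:
  "connected_by F `` {i} = connected_by F `` {j} \<longleftrightarrow> (i, j) \<in> connected_by F"
  using eq_equiv_class_iff[OF equiv_connected_by, of i j F] by simp

lemma num_components_empty: "num_components C {} = card C"
proof -
  have "C // connected_by {} = (\<lambda>x. {x}) ` C"
    by (auto simp: quotient_def connected_by_def)
  then show ?thesis by (simp add: num_components_def card_image)
qed

lemma finite_components: "finite C \<Longrightarrow> finite (C // connected_by F)"
  by (simp add: quotient_def)

text \<open>The new edge replaces the classes \<open>?A\<close> and \<open>?B\<close> of its
  endpoints, which are distinct by assumption, by their union and leaves all other classes
  alone.\<close>

lemma num_components_insert:
  assumes "finite C" "a \<in> C" "b \<in> C" "(a, b) \<notin> connected_by F"
  shows "Suc (num_components C (insert {a, b} F)) = num_components C F"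
proof -
  let ?r = "connected_by F" and ?r' = "connected_by (insert {a, b} F)"
  let ?A = "?r `` {a}" and ?B = "?r `` {b}"
  note sym = connected_by_sym[of _ _ F]
  have eq: "(x, z) \<in> ?r \<longleftrightarrow> (y, z) \<in> ?r" if "(x, y) \<in> ?r" for x y z
    using that connected_by_trans sym by metis
  have merged: "?r' `` {x} = ?A \<union> ?B" if "x \<in> ?A \<union> ?B" for x
  proof -
    from that consider "(x, a) \<in> ?r" | "(x, b) \<in> ?r" using sym[of a x] sym[of b x] by blast
    then show ?thesis
    proof cases
      case 1
      then show ?thesis using eq[OF 1] assms(4)
        unfolding set_eq_iff Image_singleton_iff Un_iff connected_by_insert by simp
    next
      case 2
      then show ?thesis using eq[OF 2] assms(4) sym[of b a]
        unfolding set_eq_iff Image_singleton_iff Un_iff connected_by_insert by auto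
    qed
  qed
  have other: "?r' `` {x} = ?r `` {x}" if "x \<notin> ?A \<union> ?B" for x
    using that sym[of x a] sym[of x b]
    unfolding set_eq_iff Image_singleton_iff Un_iff connected_by_insert by auto
  have ab: "?A \<in> C // ?r" "?B \<in> C // ?r" "?A \<noteq> ?B"
    using assms by (simp_all add: quotientI component_eq_iff)
  \<comment> \<open>Ensures that inserting the union raises the cardinality: a class equal to the
    union contains \<open>a\<close> and would thus be \<open>?A\<close>.\<close>
  have new: "?A \<union> ?B \<notin> C // ?r - {?A, ?B}"
  proof
    assume "?A \<union> ?B \<in> C // ?r - {?A, ?B}"
    then obtain x where "?A \<union> ?B = ?r `` {x}" "?r `` {x} \<noteq> ?A" by (auto simp: quotient_def)
    moreover from this(1) have "(x, a) \<in> ?r"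
      by (metis Un_iff Image_singleton_iff connected_by_refl)
    ultimately show False by (simp add: component_eq_iff)
  qed
  have "C // ?r' = insert (?A \<union> ?B) (C // ?r - {?A, ?B})"
  proof (intro equalityI subsetI)
    fix X assume "X \<in> C // ?r'"
    then obtain x where x: "x \<in> C" "X = ?r' `` {x}" by (auto simp: quotient_def)
    show "X \<in> insert (?A \<union> ?B) (C // ?r - {?A, ?B})"
    proof (cases "x \<in> ?A \<union> ?B")
      case True
      then show ?thesis using merged x by blast
    next
      case False
      then have "X = ?r `` {x}" "X \<noteq> ?A" "X \<noteq> ?B"
        using x other[OF False] sym[of x a] sym[of x b] by (auto simp: component_eq_iff)
      then show ?thesis using x by (simp add: quotientI)
    qed
  next
    fix X assume "X \<in> insert (?A \<union> ?B) (C // ?r - {?A, ?B})"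
    then consider "X = ?A \<union> ?B" | x where "x \<in> C" "X = ?r `` {x}" "X \<noteq> ?A" "X \<noteq> ?B"
      by (auto simp: quotient_def)
    then show "X \<in> C // ?r'"
    proof cases
      case 1
      then have "X = ?r' `` {a}" using merged[of a] by auto
      then show ?thesis using assms by (simp add: quotientI)
    next
      case 2
      then have "x \<notin> ?A \<union> ?B" using component_eq_iff[of F x] sym[of a x] sym[of b x] by blast
      with 2 other[of x] show ?thesis using quotientI[of x C ?r'] by simp
    qed
  qed
  then have "card (C // ?r') = Suc (card (C // ?r - {?A, ?B}))"
    using new finite_components[OF assms(1)] by simp
  moreover have "card (C // ?r - {?A, ?B}) = card (C // ?r) - 2"
    using ab finite_components[OF assms(1)] by (subst card_Diff_subset) auto
  moreover have "2 \<le> card (C // ?r)"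
    using ab finite_components[OF assms(1), of F] card_mono[of "C // ?r" "{?A, ?B}"] by auto
  ultimately show ?thesis by (simp add: num_components_def)
qed

section \<open>Forests\<close>

text \<open>The part of \<open>k_forest\<close> that passes to subsets, separated from the number of
  components, which changes when edges are removed.\<close>

definition forest :: "'a set \<Rightarrow> 'a set set \<Rightarrow> bool" where
  "forest C F \<longleftrightarrow> F \<subseteq> edges C \<and> (\<forall>i j. {i, j} \<in> F \<longrightarrow> (i, j) \<notin> connected_by (F - {{i, j}}))"

lemma k_forest_alt: "k_forest C k F \<longleftrightarrow> forest C F \<and> num_components C F = k"
  by (auto simp: k_forest_def forest_def)

lemma forest_subset:
  assumes "forest C F" "G \<subseteq> F"
  shows "forest C G"
  unfolding forest_def
proof (intro conjI allI impI)
  show "G \<subseteq> edges C" using assms by (auto simp: forest_def)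
  fix i j assume "{i, j} \<in> G"
  then have "(i, j) \<notin> connected_by (F - {{i, j}})" using assms by (auto simp: forest_def)
  moreover have "connected_by (G - {{i, j}}) \<subseteq> connected_by (F - {{i, j}})"
    using assms(2) by (intro connected_by_mono) auto
  ultimately show "(i, j) \<notin> connected_by (G - {{i, j}})" by blast
qed

text \<open>By \<open>num_components_insert\<close> each edge of a forest lowers the number of
  components by exactly one. This converts comparisons of component counts into comparisons of edge
  counts and back.\<close>

lemma forest_card:
  assumes "finite C" "forest C F"
  shows "num_components C F + card F = card C"
proof -
  have "finite F" using assms finite_edges finite_subset by (auto simp: forest_def)
  then show ?thesis using assms(2)
  proof (induction F rule: finite_induct)
    case empty
    then show ?case by (simp add: num_components_empty)
  next
    case (insert e F)
    then obtain i j where e: "e = {i, j}" "i \<in> C" "j \<in> C"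
      by (auto simp: forest_def elim: edgesE)
    have "(i, j) \<notin> connected_by F"
      using insert.hyps insert.prems by (auto simp: forest_def e(1))
    then have "Suc (num_components C (insert e F)) = num_components C F"
      using num_components_insert[OF assms(1)] e by auto
    moreover have "num_components C F + card F = card C"
      using insert.IH forest_subset[OF insert.prems] by blast
    ultimately show ?case using insert.hyps by simp
  qed
qed

text \<open>If an old edge lay on a cycle after the insertion, the rest of that cycle would pass
  through the new edge, and the old edge would complete a connection of \<open>a\<close> and
  \<open>b\<close> within \<open>F\<close>.\<close>

lemma forest_insert:
  assumes "forest C F" "a \<in> C" "b \<in> C" "(a, b) \<notin> connected_by F"
  shows "forest C (insert {a, b} F)"
  unfolding forest_def
proof (intro conjI allI impI)
  have "a \<noteq> b" using assms(4) by auto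
  then show sub: "insert {a, b} F \<subseteq> edges C" using assms by (auto simp: forest_def)
  fix i j assume ij: "{i, j} \<in> insert {a, b} F"
  show "(i, j) \<notin> connected_by (insert {a, b} F - {{i, j}})"
  proof (cases "{i, j} = {a, b}")
    case True
    then have "insert {a, b} F - {{i, j}} \<subseteq> F" by auto
    then have "connected_by (insert {a, b} F - {{i, j}}) \<subseteq> connected_by F" by (rule connected_by_mono)
    moreover have "(i, j) \<notin> connected_by F"
      using True assms(4) connected_by_sym[of i j F] by (metis doubleton_eq_iff)
    ultimately show ?thesis by blast
  next
    case False
    then have F: "{i, j} \<in> F" "insert {a, b} F - {{i, j}} = insert {a, b} (F - {{i, j}})"
      using ij by auto
    have sub: "connected_by (F - {{i, j}}) \<subseteq> connected_by F" by (rule connected_by_mono) auto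
    have "(i, j) \<in> connected_by F" using F by (auto intro: connected_by_edge)
    moreover have "(i, j) \<notin> connected_by (F - {{i, j}})"
      using assms(1) F by (auto simp: forest_def)
    moreover have "(a, b) \<in> connected_by F"
      if "(i, a) \<in> connected_by F" "(b, j) \<in> connected_by F" "(i, j) \<in> connected_by F"
      using that connected_by_sym connected_by_trans by metis
    moreover have "(a, b) \<in> connected_by F"
      if "(i, b) \<in> connected_by F" "(a, j) \<in> connected_by F" "(i, j) \<in> connected_by F"
      using that connected_by_sym connected_by_trans by metis
    ultimately show ?thesis
      unfolding F(2) connected_by_insert using assms(4) sub by blast
  qed
qed

text \<open>Sending each component of \<open>G\<close> to the component of \<open>F\<close> around
  one of its agents is onto. The agent is chosen in \<open>X \<inter> C\<close> because the
  hypothesis covers only agents in \<open>C\<close>.\<close>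

lemma num_components_antimono:
  assumes "finite C" "\<And>i j. i \<in> C \<Longrightarrow> j \<in> C \<Longrightarrow> (i, j) \<in> connected_by G \<Longrightarrow> (i, j) \<in> connected_by F"
  shows "num_components C F \<le> num_components C G"
proof -
  define h where "h X = connected_by F `` {SOME x. x \<in> X \<inter> C}" for X
  have "C // connected_by F \<subseteq> h ` (C // connected_by G)"
  proof
    fix X assume "X \<in> C // connected_by F"
    then obtain x where x: "x \<in> C" "X = connected_by F `` {x}" by (auto simp: quotient_def)
    let ?y = "SOME y. y \<in> connected_by G `` {x} \<inter> C"
    have "?y \<in> connected_by G `` {x} \<inter> C"
      using someI[of "\<lambda>y. y \<in> connected_by G `` {x} \<inter> C" x] x by simp
    then have "(x, ?y) \<in> connected_by F" using assms(2) x by auto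
    then have "X = h (connected_by G `` {x})"
      unfolding h_def x(2) by (simp add: component_eq_iff)
    then show "X \<in> h ` (C // connected_by G)" using x by (simp add: quotientI)
  qed
  then show ?thesis unfolding num_components_def
    using surj_card_le finite_components[OF assms(1)] by blast
qed

section \<open>Sums of largest entries\<close>

context
  fixes C :: "'a set" and v :: "'a \<Rightarrow> real"
  assumes finite_C: "finite C" and nonneg: "\<And>i. i \<in> C \<Longrightarrow> 0 \<le> v i"
begin

text \<open>The omitted entries are nonnegative. Together with \<open>le_Top\<close> this places
  \<open>Top l C v\<close> between the largest entry and the sum of all entries; these bounds do not
  mention \<open>l\<close>, so one estimate serves every \<open>l\<close>.\<close>

lemma Top_le_sum: "Top l C v \<le> sum v C"
proof -
  define xs where "xs = rev (sorted_list_of_multiset (image_mset v (mset_set C)))"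
  have mset: "mset xs = image_mset v (mset_set C)" by (simp add: xs_def)
  have "set xs = v ` C" using finite_C by (simp add: xs_def)
  then have "0 \<le> sum_list (drop l xs)"
    using nonneg by (intro sum_list_nonneg) (auto dest!: in_set_dropD)
  moreover have "sum_list xs = sum_list (take l xs) + sum_list (drop l xs)"
    by (metis append_take_drop_id sum_list_append)
  moreover have "sum_list xs = sum v C"
    by (metis mset sum_mset_sum_list sum_unfold_sum_mset)
  ultimately show ?thesis by (simp add: Top_def xs_def)
qed

text \<open>As \<open>l\<close> is at least 1, the head of the descending list is among the summed
  entries; it bounds every \<open>v i\<close>, and the further summands are nonnegative.\<close>

lemma le_Top:
  assumes "i \<in> C" "1 \<le> l"
  shows "v i \<le> Top l C v"
proof -
  define xs where "xs = rev (sorted_list_of_multiset (image_mset v (mset_set C)))"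
  have set: "set xs = v ` C" using finite_C by (simp add: xs_def)
  have sorted: "sorted (rev xs)" by (simp add: xs_def)
  from set assms obtain y ys where xs: "xs = y # ys" by (cases xs) auto
  from assms obtain l' where l: "l = Suc l'" by (cases l) auto
  have "\<forall>x\<in>set xs. 0 \<le> x" using nonneg set by auto
  then have "0 \<le> sum_list (take l' ys)"
    using xs by (intro sum_list_nonneg) (auto dest!: in_set_takeD)
  moreover have "v i \<le> y"
    using sorted set assms xs by (auto simp: sorted_append)
  ultimately show ?thesis using xs l by (simp add: Top_def flip: xs_def)
qed

end


section \<open>Instances\<close>

locale boruvka_input =
  fixes C :: "'a set" and d :: "'a \<Rightarrow> 'a \<Rightarrow> real" and \<sigma> :: "'a \<Rightarrow> 'a rel" and tie :: "'a set rel"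
  assumes finite_C: "finite C" and metric: "metric_on C d"
    and profile: "profile_on C \<sigma>" and consistent: "consistent C d \<sigma>"
    and tie: "linear_order_on (edges C) tie"
begin

abbreviation cost :: "'a set \<Rightarrow> real" where "cost \<equiv> edge_cost d"

lemma dist_self: "i \<in> C \<Longrightarrow> d i i = 0"
  and dist_nonneg: "i \<in> C \<Longrightarrow> j \<in> C \<Longrightarrow> 0 \<le> d i j"
  and dist_commute: "i \<in> C \<Longrightarrow> j \<in> C \<Longrightarrow> d i j = d j i"
  and dist_triangle: "i \<in> C \<Longrightarrow> j \<in> C \<Longrightarrow> h \<in> C \<Longrightarrow> d i h \<le> d i j + d j h"
  using metric unfolding metric_on_def by blast+

lemma edge_cost_eq: "i \<in> C \<Longrightarrow> j \<in> C \<Longrightarrow> cost {i, j} = d i j"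
  unfolding edge_cost_def by (rule the_equality) (auto simp: doubleton_eq_iff dist_commute)

lemma edge_cost_nonneg: "e \<in> edges C \<Longrightarrow> 0 \<le> cost e"
  by (elim edgesE) (simp add: edge_cost_eq dist_nonneg)

lemma finite_edge_set: "F \<subseteq> edges C \<Longrightarrow> finite F"
  using finite_edges[OF finite_C] by (rule finite_subset[rotated])


section \<open>Edges that are cheapest in a cut\<close>

text \<open>\<open>\<rho>\<close> is the round in which an edge was chosen. It must precede the tie-breaking rule: an edge
  may be chosen before the cost of a tied edge that the rule prefers becomes known.\<close>

definition precedes :: "('a set \<Rightarrow> nat) \<Rightarrow> 'a set \<Rightarrow> 'a set \<Rightarrow> bool" where
  "precedes \<rho> e f \<longleftrightarrow>
     cost e < cost f \<or> cost e = cost f \<and> (\<rho> e < \<rho> f \<or> \<rho> e = \<rho> f \<and> (e, f) \<in> tie)"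

text \<open>Within \<open>F\<close> ties are resolved, so that the last edge of \<open>F\<close> is
  the only edge of \<open>F\<close> in its cut. Against the other edges of the cut only cost is
  compared, which suffices for minimality.\<close>

definition cut_optimal :: "('a set \<Rightarrow> nat) \<Rightarrow> 'a set set \<Rightarrow> bool" where
  "cut_optimal \<rho> F \<longleftrightarrow> F \<subseteq> edges C \<and>
     (\<forall>f\<in>F. \<exists>S. f \<in> cut C S \<and> (\<forall>g\<in>cut C S. cost f \<le> cost g) \<and> (\<forall>g\<in>F \<inter> cut C S. precedes \<rho> f g))"

lemma precedes_antisym: "precedes \<rho> e f \<Longrightarrow> precedes \<rho> f e \<Longrightarrow> e = f"
  using linear_order_onE(3)[OF tie] unfolding precedes_def by auto

lemma precedes_imp_cost_le: "precedes \<rho> e f \<Longrightarrow> cost e \<le> cost f"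
  by (auto simp: precedes_def)

lemma ex_last_edge:
  assumes "F \<subseteq> edges C" "F \<noteq> {}"
  shows "\<exists>f\<in>F. \<forall>g\<in>F. precedes \<rho> g f"
proof -
  have "\<exists>!f. f \<in> F \<and> (\<forall>g\<in>F. precedes \<rho> g f)"
  proof (rule finite_least)
    show "finite F" "F \<noteq> {}" using assms finite_edge_set by auto
    show "precedes \<rho> y x \<or> precedes \<rho> x y" if "x \<in> F" "y \<in> F" for x y
      using that assms linear_order_onE(1)[OF tie, of x y] unfolding precedes_def by fastforce
    show "precedes \<rho> z x" if "precedes \<rho> y x" "precedes \<rho> z y" for x y z
      using that linear_order_onE(2)[OF tie, of z y x] unfolding precedes_def by force
    show "x = y" if "precedes \<rho> y x" "precedes \<rho> x y" for x y
      using that precedes_antisym by blast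
  qed
  then show ?thesis by blast
qed

text \<open>Peels off the last edge \<open>f\<close> in the order \<open>precedes \<rho>\<close>.
  All of \<open>F\<close> precedes \<open>f\<close>, while \<open>f\<close> precedes the edges of
  \<open>F\<close> in its own cut, so by antisymmetry no other edge of \<open>F\<close> is in that
  cut. Read forwards, edges are inserted by non-decreasing cost.\<close>

lemma cut_optimal_induct [consumes 1, case_names empty insert]:
  assumes "cut_optimal \<rho> F" "P {}"
    and step: "\<And>F i j S. cut_optimal \<rho> F \<Longrightarrow> P F \<Longrightarrow> {i, j} \<notin> F \<Longrightarrow> F \<inter> cut C S = {} \<Longrightarrow>
      i \<in> C \<Longrightarrow> j \<in> C \<Longrightarrow> i \<in> S \<Longrightarrow> j \<notin> S \<Longrightarrow> (\<And>g. g \<in> cut C S \<Longrightarrow> cost {i, j} \<le> cost g) \<Longrightarrow>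
      (\<And>g. g \<in> F \<Longrightarrow> cost g \<le> cost {i, j}) \<Longrightarrow> P (insert {i, j} F)"
  shows "P F"
  using assms(1)
proof (induction "card F" arbitrary: F)
  case 0
  then show ?case using finite_edge_set[of F] assms(2) by (auto simp: cut_optimal_def)
next
  case (Suc n)
  have sub: "F \<subseteq> edges C" using Suc.prems by (simp add: cut_optimal_def)
  obtain f where f: "f \<in> F" "\<forall>g\<in>F. precedes \<rho> g f"
    using ex_last_edge[OF sub] Suc.hyps(2) by fastforce
  obtain S where S: "f \<in> cut C S" "\<forall>g\<in>cut C S. cost f \<le> cost g" "\<forall>g\<in>F \<inter> cut C S. precedes \<rho> f g"
    using Suc.prems f by (auto simp: cut_optimal_def)
  obtain i j where ij: "f = {i, j}" "i \<in> C" "j \<in> C" "i \<in> S" "j \<notin> S"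
    using S(1) by (rule cutE)
  have opt: "cut_optimal \<rho> (F - {f})"
    using Suc.prems unfolding cut_optimal_def by blast
  have "P (insert {i, j} (F - {f}))"
  proof (rule step[OF opt _ _ _ ij(2-5)])
    show "P (F - {f})"
      using Suc.hyps(1)[OF _ opt] Suc.hyps(2) f(1) by simp
    show "{i, j} \<notin> F - {f}" using ij by simp
    show "(F - {f}) \<inter> cut C S = {}" using S(3) f(2) precedes_antisym by blast
  qed (use S(2) f(2) ij(1) precedes_imp_cost_le in auto)
  then show ?case using f(1) ij(1) by (simp add: insert_absorb)
qed

lemma cut_optimal_edges: "cut_optimal \<rho> F \<Longrightarrow> F \<subseteq> edges C"
  by (simp add: cut_optimal_def)

text \<open>Each edge is inserted across a cut that no earlier edge crosses, so it joins two
  different components.\<close>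

lemma cut_optimal_forest: "cut_optimal \<rho> F \<Longrightarrow> forest C F"
proof (induction rule: cut_optimal_induct)
  case empty
  then show ?case by (simp add: forest_def)
next
  case (insert F i j S)
  have "(i, j) \<notin> connected_by F"
    using connected_by_not_cut[OF cut_optimal_edges[OF insert.hyps(1)] insert.hyps(3)]
      insert.hyps(6,7) by blast
  then show ?case using forest_insert[OF insert.IH insert.hyps(4,5)] by blast
qed

text \<open>If \<open>x\<close> and \<open>y\<close> become connected only through the inserted
  edge, they lie on different sides of its cut. Then \<open>{x, y}\<close> is in the cut and costs
  at least as much as the inserted edge, hence as every edge present, and the filter by cost removes
  nothing.\<close>

lemma cut_optimal_bottleneck:
  assumes "cut_optimal \<rho> F" "(x, y) \<in> connected_by F" "x \<in> C" "y \<in> C"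
  shows "(x, y) \<in> connected_by {e \<in> F. cost e \<le> d x y}"
  using assms
proof (induction rule: cut_optimal_induct)
  case empty
  then show ?case by simp
next
  case (insert F i j S)
  show ?case
  proof (cases "(x, y) \<in> connected_by F")
    case True
    have "connected_by {e \<in> F. cost e \<le> d x y} \<subseteq> connected_by {e \<in> insert {i, j} F. cost e \<le> d x y}"
      by (intro connected_by_mono) auto
    with insert.IH[OF True insert.prems(2,3)] show ?thesis by blast
  next
    case False
    then have "(x, i) \<in> connected_by F \<and> (j, y) \<in> connected_by F \<or>
        (x, j) \<in> connected_by F \<and> (i, y) \<in> connected_by F"
      using insert.prems(1) by (simp add: connected_by_insert)
    then have "x \<in> S \<longleftrightarrow> y \<notin> S"
      using connected_by_not_cut[OF cut_optimal_edges[OF insert.hyps(1)] insert.hyps(3)]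
        insert.hyps(6,7) by blast
    then have "cost {i, j} \<le> d x y"
      using insert.hyps(8)[of "{x, y}"] insert.prems by (simp add: edge_cost_eq)
    then have "{e \<in> insert {i, j} F. cost e \<le> d x y} = insert {i, j} F"
      using insert.hyps(9) by force
    then show ?thesis using insert.prems by simp
  qed
qed


section \<open>Minimum-cost forests\<close>

text \<open>By the bottleneck property the endpoints of every edge of \<open>G\<close> of cost at
  most \<open>c\<close> are connected by edges of \<open>F\<close> of cost at most \<open>c\<close>.
  The latter thus leave no more components, and in forests fewer components mean more edges.\<close>

lemma cut_optimal_count_le:
  assumes F: "cut_optimal \<rho> F" "num_components C F = 1" and G: "forest C G"
  shows "card {e \<in> G. cost e \<le> c} \<le> card {e \<in> F. cost e \<le> c}"
proof -
  have sub: "{e \<in> F. cost e \<le> c} \<subseteq> F" "{e \<in> G. cost e \<le> c} \<subseteq> G" by auto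
  have spanning: "(x, y) \<in> connected_by F" if "x \<in> C" "y \<in> C" for x y
  proof -
    obtain X where "C // connected_by F = {X}"
      using F(2) by (auto simp: num_components_def card_1_singleton_iff)
    then have "connected_by F `` {x} = connected_by F `` {y}"
      using that by (metis quotientI singletonD)
    then show ?thesis by (simp add: component_eq_iff)
  qed
  have "num_components C {e \<in> F. cost e \<le> c} \<le> num_components C {e \<in> G. cost e \<le> c}"
  proof (rule num_components_antimono[OF finite_C])
    fix x y assume "(x, y) \<in> connected_by {e \<in> G. cost e \<le> c}"
    then show "(x, y) \<in> connected_by {e \<in> F. cost e \<le> c}"
      unfolding connected_by_def[of "{e \<in> G. cost e \<le> c}"]
    proof (induction rule: rtrancl_induct)
      case base
      then show ?case by simp
    next
      case (step y z)
      then have yz: "y \<in> C" "z \<in> C" "cost {y, z} \<le> c"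
        using G edge_endpoints[of G C y z] by (auto simp: forest_def)
      then have "(y, z) \<in> connected_by {e \<in> F. cost e \<le> d y z}"
        using cut_optimal_bottleneck[OF F(1)] spanning by blast
      moreover have "connected_by {e \<in> F. cost e \<le> d y z} \<subseteq> connected_by {e \<in> F. cost e \<le> c}"
        using yz by (intro connected_by_mono) (auto simp: edge_cost_eq)
      ultimately show ?case using connected_by_trans[OF step.IH] by blast
    qed
  qed
  moreover note forest_card[OF finite_C forest_subset[OF cut_optimal_forest[OF F(1)] sub(1)]]
    forest_card[OF finite_C forest_subset[OF G sub(2)]]
  ultimately show ?thesis by linarith
qed

lemma cheapest_edges_minimal:
  assumes F: "cut_optimal \<rho> F" "num_components C F = 1"
    and P: "P \<subseteq> F" "\<And>e g. e \<in> P \<Longrightarrow> g \<in> F - P \<Longrightarrow> cost e \<le> cost g" "num_components C P = k"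
    and G: "k_forest C k G"
  shows "sum cost P \<le> sum cost G"
proof -
  have forest: "forest C P" "forest C G"
    using forest_subset[OF cut_optimal_forest[OF F(1)] P(1)] G by (auto simp: k_forest_alt)
  show ?thesis
  proof (rule sum_le_if_counts_le)
    show fin: "finite P" "finite G" using forest finite_edge_set by (auto simp: forest_def)
    show card: "card P = card G"
      using forest_card[OF finite_C forest(1)] forest_card[OF finite_C forest(2)] P(3) G
      by (simp add: k_forest_alt)
    \<comment> \<open>If some edge of \<open>P\<close> is dearer than \<open>c\<close>, all edges of
      \<open>F\<close> of cost at most \<open>c\<close> belong to \<open>P\<close> and
      \<open>cut_optimal_count_le\<close> applies. Otherwise all of \<open>P\<close> is counted, and
      \<open>P\<close> has as many edges as \<open>G\<close>.\<close>
    show "card {e \<in> G. cost e \<le> c} \<le> card {e \<in> P. cost e \<le> c}" for c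
    proof (cases "\<exists>p\<in>P. c < cost p")
      case True
      then have "{e \<in> P. cost e \<le> c} = {e \<in> F. cost e \<le> c}" using P(1,2) by force
      then show ?thesis using cut_optimal_count_le[OF F forest(2)] by simp
    next
      case False
      then have "{e \<in> P. cost e \<le> c} = P" by force
      moreover have "card {e \<in> G. cost e \<le> c} \<le> card G"
        using fin by (intro card_mono) auto
      ultimately show ?thesis using card by simp
    qed
  qed
qed

lemma finite_forest_costs: "finite {sum cost F | F. k_forest C k F}"
proof (rule finite_subset)
  show "{sum cost F | F. k_forest C k F} \<subseteq> sum cost ` Pow (edges C)"
    by (auto simp: k_forest_def)
qed (simp add: finite_edges[OF finite_C])

lemma min_k_forest_cost_eq:
  assumes "k_forest C k P" "\<And>G. k_forest C k G \<Longrightarrow> sum cost P \<le> sum cost G"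
  shows "min_k_forest_cost C d k = sum cost P"
  unfolding min_k_forest_cost_def
  by (rule Min_eqI) (use assms finite_forest_costs in auto)


section \<open>Forests and the centrum problem\<close>

text \<open>The first edge of a walk is removed before the induction hypothesis is applied, so each
  edge of \<open>F\<close> is paid for only once. Either \<open>h\<close> reaches \<open>j\<close>
  without that edge and the triangle inequality applies, or \<open>i\<close> itself reaches
  \<open>j\<close> without it.\<close>

lemma dist_le_sum_cost:
  assumes "F \<subseteq> edges C" "(i, j) \<in> connected_by F" "i \<in> C" "j \<in> C"
  shows "d i j \<le> sum cost F"
  using assms
proof (induction "card F" arbitrary: F i rule: less_induct)
  case less
  note fin = finite_edge_set[OF less.prems(1)]
  show ?case
  proof (cases "i = j")
    case True
    have "0 \<le> sum cost F" using less.prems(1) edge_cost_nonneg by (intro sum_nonneg) blast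
    with True less.prems(3) show ?thesis by (simp add: dist_self)
  next
    case False
    obtain h where h: "{i, h} \<in> F" "(h, j) \<in> connected_by F"
      using less.prems(2)[unfolded connected_by_def]
      by (rule converse_rtranclE) (use False in \<open>auto simp: connected_by_def\<close>)
    let ?G = "F - {{i, h}}"
    have hC: "h \<in> C" using edge_endpoints[OF less.prems(1) h(1)] by simp
    have G: "card ?G < card F" "?G \<subseteq> edges C"
      using card_Diff1_less[OF fin h(1)] less.prems(1) by auto
    have sum: "sum cost F = d i h + sum cost ?G"
      using sum.remove[OF fin h(1), of cost] hC less.prems by (simp add: edge_cost_eq)
    have "(h, j) \<in> connected_by (insert {i, h} ?G)" using h by (simp add: insert_absorb)
    then consider "(h, j) \<in> connected_by ?G" | "(i, j) \<in> connected_by ?G"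
      unfolding connected_by_insert by blast
    then show ?thesis
    proof cases
      case 1
      have "d h j \<le> sum cost ?G" using less.hyps[OF G 1 hC less.prems(4)] .
      then show ?thesis using sum dist_triangle[of i h j] hC less.prems by linarith
    next
      case 2
      have "d i j \<le> sum cost ?G" using less.hyps[OF G 2 less.prems(3,4)] .
      then show ?thesis using sum dist_nonneg[of i h] hC less.prems by linarith
    qed
  qed
qed

lemma dist_to_set_nonneg:
  assumes "S \<subseteq> C" "S \<noteq> {}" "i \<in> C"
  shows "0 \<le> dist_to_set d i S"
  using assms finite_subset[OF assms(1) finite_C]
  unfolding dist_to_set_def by (subst Min_ge_iff) (auto intro: dist_nonneg)

lemma finite_centrum_values:
  "finite {Top l C (\<lambda>i. dist_to_set d i S) | S. S \<subseteq> C \<and> S \<noteq> {} \<and> card S \<le> k}"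
  by (rule finite_subset[of _ "(\<lambda>S. Top l C (\<lambda>i. dist_to_set d i S)) ` Pow C"])
    (auto simp: finite_C)

text \<open>The factor \<open>card C\<close> arises from bounding \<open>Top\<close> by the sum over
  all agents, each of which is connected in \<open>P\<close> to the representative of its
  component.\<close>

lemma OPT_le_forest_cost:
  assumes "C \<noteq> {}" "k_forest C k P"
  shows "OPT C d k l \<le> card C * sum cost P"
proof -
  note P = assms(2)[unfolded k_forest_def num_components_def]
  define rep where "rep X = (SOME x. x \<in> X)" for X :: "'a set"
  define S where "S = rep ` (C // connected_by P)"
  have rep: "(i, rep (connected_by P `` {i})) \<in> connected_by P" for i
    unfolding rep_def using someI[of "\<lambda>x. x \<in> connected_by P `` {i}" i] by simp
  then have rep_C: "rep (connected_by P `` {i}) \<in> C" if "i \<in> C" for i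
    using that connected_by_closed[OF _ rep[of i], of C] P by simp
  have S: "S \<subseteq> C" "S \<noteq> {}" "card S \<le> k"
    using rep_C assms card_image_le[OF finite_components[OF finite_C], of rep P] P
    by (auto simp: S_def quotient_def)
  have dist: "dist_to_set d i S \<le> sum cost P" if "i \<in> C" for i
  proof -
    have "rep (connected_by P `` {i}) \<in> S" using that by (simp add: S_def quotientI)
    then have "dist_to_set d i S \<le> d i (rep (connected_by P `` {i}))"
      unfolding dist_to_set_def using finite_subset[OF S(1) finite_C] by (intro Min_le) auto
    also have "\<dots> \<le> sum cost P"
      using dist_le_sum_cost[OF _ rep that rep_C[OF that]] P by simp
    finally show ?thesis .
  qed
  have "OPT C d k l \<le> Top l C (\<lambda>i. dist_to_set d i S)"
    unfolding OPT_def using S by (intro Min_le finite_centrum_values) auto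
  also have "\<dots> \<le> (\<Sum>i\<in>C. dist_to_set d i S)"
    by (intro Top_le_sum finite_C dist_to_set_nonneg S)
  also have "\<dots> \<le> card C * sum cost P"
    using sum_bounded_above[of C "\<lambda>i. dist_to_set d i S", OF dist] by simp
  finally show ?thesis .
qed

text \<open>The witness is the star forest that joins every agent to a nearest member of \<open>S\<close>.\<close>

lemma ex_k_forest_cost_le:
  assumes "S \<subseteq> C" "S \<noteq> {}" "card S = k"
  shows "\<exists>G. k_forest C k G \<and> sum cost G \<le> (\<Sum>i\<in>C. dist_to_set d i S)"
proof -
  have finS: "finite S" using assms(1) finite_C by (rule finite_subset)
  have "\<exists>a\<in>S. d i a = dist_to_set d i S" for i
    unfolding dist_to_set_def using Min_in[of "d i ` S"] finS assms(2) by fastforce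
  then obtain a where a: "\<And>i. a i \<in> S" "\<And>i. d i (a i) = dist_to_set d i S" by metis
  define G where "G = (\<lambda>i. {i, a i}) ` (C - S)"
  \<comment> \<open>The edge determines \<open>i\<close> as its endpoint outside
    \<open>S\<close>.\<close>
  have inj: "inj_on (\<lambda>i. {i, a i}) (C - S)"
    using a(1) by (intro inj_onI) (auto simp: doubleton_eq_iff)
  have GE: "G \<subseteq> edges C" using a(1) assms(1) by (force simp: G_def)
  \<comment> \<open>An agent \<open>i\<close> outside \<open>S\<close> is a leaf: no other edge of
    \<open>G\<close> contains it, so it is isolated once its own edge is removed.\<close>
  have isolated: "(i, j) \<notin> connected_by (G - {{i, j}})" if "{i, j} = {i, a i}" "i \<in> C - S" for i j
  proof
    assume "(i, j) \<in> connected_by (G - {{i, j}})"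
    then have "i = i \<longleftrightarrow> j = i"
    proof (rule connected_by_cong[where P = "\<lambda>x. x = i"])
      fix x y assume "{x, y} \<in> G - {{i, j}}"
      then show "x = i \<longleftrightarrow> y = i"
        using that a(1) by (auto simp: G_def doubleton_eq_iff)
    qed
    then show False using that a(1)[of i] by (auto simp: doubleton_eq_iff)
  qed
  have forest: "forest C G"
    unfolding forest_def
  proof (intro conjI allI impI GE)
    fix i j assume "{i, j} \<in> G"
    then obtain h where h: "h \<in> C - S" "{i, j} = {h, a h}" by (auto simp: G_def)
    then consider "i = h" "j = a h" | "i = a h" "j = h" by (auto simp: doubleton_eq_iff)
    then show "(i, j) \<notin> connected_by (G - {{i, j}})"
    proof cases
      case 1
      then show ?thesis using isolated[of i j] h by simp
    next
      case 2
      then have "(j, i) \<notin> connected_by (G - {{j, i}})"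
        using isolated[of j i] h by simp
      then show ?thesis using connected_by_sym[of i j] by (metis insert_commute)
    qed
  qed
  have "card G = card C - k"
    unfolding G_def card_image[OF inj] using assms finS by (simp add: card_Diff_subset)
  moreover have "k \<le> card C" using assms card_mono[OF finite_C] by blast
  ultimately have "k_forest C k G"
    using forest_card[OF finite_C forest] forest by (simp add: k_forest_alt)
  moreover have "sum cost G = (\<Sum>i\<in>C - S. d i (a i))"
    unfolding G_def sum.reindex[OF inj] using a(1) assms(1)
    by (intro sum.cong) (auto simp: edge_cost_eq subset_iff)
  moreover have "\<dots> \<le> (\<Sum>i\<in>C. dist_to_set d i S)"
    unfolding a(2) using finite_C assms dist_to_set_nonneg by (intro sum_mono2) auto
  ultimately show ?thesis by auto
qed

text \<open>Every agent's distance to an optimal solution is bounded by the largest entry and so by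
  the optimum; summing these distances gives the factor \<open>card C\<close>.\<close>

lemma ex_k_forest_cost_le_OPT:
  assumes "1 \<le> k" "k \<le> card C" "1 \<le> l"
  shows "\<exists>G. k_forest C k G \<and> sum cost G \<le> card C * OPT C d k l"
proof -
  have "{Top l C (\<lambda>i. dist_to_set d i S) | S. S \<subseteq> C \<and> S \<noteq> {} \<and> card S \<le> k} \<noteq> {}"
  proof -
    from assms obtain c where "c \<in> C" by fastforce
    then have "{c} \<subseteq> C \<and> {c} \<noteq> {} \<and> card {c} \<le> k" using assms by simp
    then show ?thesis by blast
  qed
  from Min_in[OF finite_centrum_values this] obtain S where
    S: "S \<subseteq> C" "S \<noteq> {}" "card S \<le> k" and OPT: "OPT C d k l = Top l C (\<lambda>i. dist_to_set d i S)"
    by (auto simp: OPT_def)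
  \<comment> \<open>The optimal \<open>S\<close> may have fewer than \<open>k\<close> members, but
    the forest needs exactly \<open>k\<close> components. Enlarging \<open>S\<close> only decreases
    distances.\<close>
  obtain T where T: "S \<subseteq> T" "T \<subseteq> C" "card T = k"
    using exists_subset_between[OF S(3) assms(2) S(1) finite_C] by blast
  then have ne: "T \<noteq> {}" using S by auto
  obtain G where G: "k_forest C k G" "sum cost G \<le> (\<Sum>i\<in>C. dist_to_set d i T)"
    using ex_k_forest_cost_le[OF T(2) ne T(3)] by blast
  have "dist_to_set d i T \<le> OPT C d k l" if "i \<in> C" for i
  proof -
    have "dist_to_set d i T \<le> dist_to_set d i S"
      unfolding dist_to_set_def using T S finite_subset[OF T(2) finite_C] by (intro Min_antimono) auto
    also have "\<dots> \<le> OPT C d k l"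
      unfolding OPT
      using that assms(3) by (intro le_Top[where v = "\<lambda>i. dist_to_set d i S"] finite_C dist_to_set_nonneg[OF S(1,2)])
    finally show ?thesis .
  qed
  then have "(\<Sum>i\<in>C. dist_to_set d i T) \<le> card C * OPT C d k l"
    using sum_bounded_above[of C "\<lambda>i. dist_to_set d i T"] by simp
  with G show ?thesis by force
qed

end

section \<open>Contraction\<close>

text \<open>Moving inside a component of \<open>F\<close> is invisible on supernodes, and every
  other edge of \<open>F'\<close> joins two components of \<open>F\<close> and is therefore in
  \<open>crossing\<close>. Conversely, a step of \<open>R\<close> never leaves a component of
  \<open>F'\<close>.\<close>

lemma contract_components:
  assumes sub: "F \<subseteq> F'" and F': "F' \<subseteq> edges C"
  shows "contract (C // connected_by F) (F' \<inter> crossing C (C // connected_by F)) = C // connected_by F'"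
proof -
  let ?V = "C // connected_by F" and ?E = "F' \<inter> crossing C (C // connected_by F)"
  let ?cl = "\<lambda>i. connected_by F `` {i}"
  define R where "R = {(S, T). S \<in> ?V \<and> T \<in> ?V \<and> (\<exists>i\<in>S. \<exists>j\<in>T. {i, j} \<in> ?E)}"
  have mono: "connected_by F \<subseteq> connected_by F'" using sub by (rule connected_by_mono)
  have to_R: "(?cl i, ?cl j) \<in> R\<^sup>*" if "i \<in> C" "(i, j) \<in> connected_by F'" for i j
    using that(2) unfolding connected_by_def[of F']
  proof (induction rule: rtrancl_induct)
    case base
    then show ?case by simp
  next
    case (step j h)
    then have jh: "j \<in> C" "h \<in> C" "{j, h} \<in> F'" using edge_endpoints[OF F'] by auto
    show ?case
    proof (cases "(j, h) \<in> connected_by F")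
      case True
      then show ?thesis using step.IH component_eq_iff[of F j h] by simp
    next
      case False
      have "\<not> {j, h} \<subseteq> S" if "S \<in> ?V" for S
      proof
        assume "{j, h} \<subseteq> S"
        moreover from that obtain x where "S = ?cl x" by (rule quotientE)
        ultimately have "(x, j) \<in> connected_by F" "(x, h) \<in> connected_by F" by auto
        from connected_by_trans[OF connected_by_sym[OF this(1)] this(2)] False show False by blast
      qed
      then have "{j, h} \<in> ?E" using jh(3) F' unfolding crossing_def by blast
      then have "(?cl j, ?cl h) \<in> R"
        unfolding R_def using jh quotientI[of _ C "connected_by F"]
          connected_by_refl[of j F] connected_by_refl[of h F] by blast
      then show ?thesis using step.IH by (rule rtrancl_into_rtrancl[rotated])
    qed
  qed
  have from_R: "T \<in> ?V \<and> T \<subseteq> connected_by F' `` {i}" if "i \<in> C" "(?cl i, T) \<in> R\<^sup>*" for i T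
    using that(2)
  proof (induction rule: rtrancl_induct)
    case base
    then show ?case using that(1) mono by (auto simp: quotientI)
  next
    case (step S T)
    then obtain j h where jh: "j \<in> S" "h \<in> T" "{j, h} \<in> F'" "T \<in> ?V" by (auto simp: R_def)
    from this(4) obtain x where x: "T = ?cl x" by (rule quotientE)
    have "(i, j) \<in> connected_by F'" using step.IH jh by blast
    then have ih: "(i, h) \<in> connected_by F'"
      using connected_by_edge[OF jh(3)] by (rule connected_by_trans)
    have "(h, y) \<in> connected_by F'" if "y \<in> T" for y
    proof -
      have "(x, h) \<in> connected_by F" "(x, y) \<in> connected_by F" using that jh x by auto
      from connected_by_trans[OF connected_by_sym[OF this(1)] this(2)] mono show ?thesis by blast
    qed
    then show ?case using jh(4) connected_by_trans[OF ih] by blast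
  qed
  have union: "\<Union> (R\<^sup>* `` {?cl i}) = connected_by F' `` {i}" if "i \<in> C" for i
  proof
    show "\<Union> (R\<^sup>* `` {?cl i}) \<subseteq> connected_by F' `` {i}" using from_R[OF that] by blast
    show "connected_by F' `` {i} \<subseteq> \<Union> (R\<^sup>* `` {?cl i})"
    proof
      fix j assume "j \<in> connected_by F' `` {i}"
      then have "(?cl i, ?cl j) \<in> R\<^sup>*" using to_R[OF that] by blast
      then show "j \<in> \<Union> (R\<^sup>* `` {?cl i})" using connected_by_refl[of j F] by blast
    qed
  qed
  have "contract ?V ?E = (\<lambda>S. \<Union> (R\<^sup>* `` {S})) ` ?V"
    unfolding contract_def R_def quotient_def by auto
  also have "\<dots> = (\<lambda>i. \<Union> (R\<^sup>* `` {?cl i})) ` C"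
    unfolding quotient_def by auto
  also have "\<dots> = C // connected_by F'"
    unfolding quotient_def using union by auto
  finally show ?thesis .
qed

text \<open>Every component of \<open>F'\<close> contains at least two components of
  \<open>F\<close>: any one of them has an edge of \<open>F'\<close> leaving it, whose far endpoint
  lies in a second one. The fibres of \<open>h\<close> count the old components by the new one
  around them.\<close>

lemma components_halved:
  assumes "finite C" and sub: "F \<subseteq> F'" and F': "F' \<subseteq> edges C"
    and cuts: "\<And>S. S \<in> C // connected_by F \<Longrightarrow> F' \<inter> cut C S \<noteq> {}"
  shows "2 * card (C // connected_by F') \<le> card (C // connected_by F)"
proof -
  let ?V = "C // connected_by F" and ?V' = "C // connected_by F'"
  note fin = finite_components[OF assms(1)]
  define h where "h S = connected_by F' `` S" for S
  have mono: "connected_by F \<subseteq> connected_by F'" using sub by (rule connected_by_mono)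
  have h: "h (connected_by F `` {x}) = connected_by F' `` {x}" for x
  proof
    show "h (connected_by F `` {x}) \<subseteq> connected_by F' `` {x}"
      unfolding h_def using mono connected_by_trans[of x _ F'] by blast
    show "connected_by F' `` {x} \<subseteq> h (connected_by F `` {x})"
      unfolding h_def using connected_by_refl[of x F] by blast
  qed
  have two: "2 \<le> card {S \<in> ?V. h S = X}" if "X \<in> ?V'" for X
  proof -
    from that obtain x where x: "x \<in> C" "X = connected_by F' `` {x}" by (auto simp: quotient_def)
    let ?S = "connected_by F `` {x}"
    have S: "?S \<in> ?V" using x by (simp add: quotientI)
    then obtain e where e: "e \<in> F'" "e \<in> cut C ?S" using cuts by blast
    obtain i j where ij: "e = {i, j}" "j \<in> C" "i \<in> ?S" "j \<notin> ?S"
      using e(2) by (rule cutE)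
    let ?T = "connected_by F `` {j}"
    have "(x, i) \<in> connected_by F'" using ij mono by blast
    then have "(x, j) \<in> connected_by F'"
      using e ij by (auto intro: connected_by_trans connected_by_edge)
    then have "h ?T = X" unfolding h x(2) using component_eq_iff[of F' x j] by simp
    moreover have "h ?S = X" by (simp only: h x(2))
    moreover have "?T \<in> ?V" using ij by (simp add: quotientI)
    ultimately have "{?S, ?T} \<subseteq> {S \<in> ?V. h S = X}" using S by simp
    moreover have "?S \<noteq> ?T" using ij by (auto simp: component_eq_iff)
    ultimately show ?thesis
      using card_mono[of "{S \<in> ?V. h S = X}" "{?S, ?T}"] fin by simp
  qed
  have "h ` ?V \<subseteq> ?V'"
    using h by (auto simp: quotient_def)
  then have "card ?V = (\<Sum>X\<in>?V'. card {S \<in> ?V. h S = X})"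
    using sum.group[OF fin fin, of h F F' "\<lambda>_. 1 :: nat"] by simp
  also have "\<dots> \<ge> (\<Sum>X\<in>?V'. 2)" by (intro sum_mono two)
  finally show ?thesis by simp
qed


section \<open>Correctness of Boruvka\<close>

context boruvka_input
begin

section \<open>Known costs and choices by cost\<close>

definition sound :: "('a \<times> 'a \<rightharpoonup> real) \<Rightarrow> bool" where
  "sound m \<longleftrightarrow> (\<forall>i a x. m (i, a) = Some x \<longrightarrow> i \<in> C \<and> a \<in> C \<and> x = d i a)"

text \<open>Either endpoint may have reported the edge; both reports agree because \<open>d\<close>
  is symmetric.\<close>

lemma known_cost_eq:
  assumes "sound m" "e \<in> known_edges m"
  shows "known_cost m e = cost e"
proof -
  from assms(2) obtain i a x where e: "e = {i, a}" "m (i, a) = Some x"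
    by (auto simp: known_edges_def)
  with assms(1) have "i \<in> C" "a \<in> C" by (auto simp: sound_def)
  have "known_cost m e = d i a"
    unfolding known_cost_def
  proof (rule the_equality)
    show "\<exists>j b. e = {j, b} \<and> m (j, b) = Some (d i a)"
      using e assms(1) unfolding sound_def by blast
    fix y assume "\<exists>j b. e = {j, b} \<and> m (j, b) = Some y"
    then obtain j b where "e = {j, b}" "j \<in> C" "b \<in> C" "y = d j b"
      using assms(1) unfolding sound_def by blast
    then show "y = d i a" using e(1) dist_commute[of j b] by (auto simp: doubleton_eq_iff)
  qed
  with e \<open>i \<in> C\<close> \<open>a \<in> C\<close> show ?thesis by (simp add: edge_cost_eq)
qed

lemma cheapest:
  assumes "A \<subseteq> edges C" "A \<noteq> {}"
  shows "cheapest tie m A \<in> A" "\<And>f. f \<in> A \<Longrightarrow> no_dearer tie m (cheapest tie m A) f"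
proof -
  have "\<exists>!e. e \<in> A \<and> (\<forall>f\<in>A. no_dearer tie m e f)"
  proof (rule finite_least)
    show "finite A" "A \<noteq> {}" using assms finite_edge_set by auto
    show "no_dearer tie m x y \<or> no_dearer tie m y x" if "x \<in> A" "y \<in> A" for x y
      using that assms linear_order_onE(1)[OF tie, of x y] unfolding no_dearer_def by fastforce
    show "no_dearer tie m x z" if "no_dearer tie m x y" "no_dearer tie m y z" for x y z
      using that linear_order_onE(2)[OF tie, of x y z] unfolding no_dearer_def by force
    show "x = y" if "no_dearer tie m x y" "no_dearer tie m y x" for x y
      using that linear_order_onE(3)[OF tie] unfolding no_dearer_def by auto
  qed
  from theI'[OF this] show "cheapest tie m A \<in> A"
    "\<And>f. f \<in> A \<Longrightarrow> no_dearer tie m (cheapest tie m A) f"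
    unfolding cheapest_def by blast+
qed

lemma dearest:
  assumes "A \<subseteq> edges C" "A \<noteq> {}"
  shows "dearest tie m A \<in> A" "\<And>f. f \<in> A \<Longrightarrow> no_dearer tie m f (dearest tie m A)"
proof -
  have "\<exists>!e. e \<in> A \<and> (\<forall>f\<in>A. no_dearer tie m f e)"
  proof (rule finite_least)
    show "finite A" "A \<noteq> {}" using assms finite_edge_set by auto
    show "no_dearer tie m y x \<or> no_dearer tie m x y" if "x \<in> A" "y \<in> A" for x y
      using that assms linear_order_onE(1)[OF tie, of x y] unfolding no_dearer_def by fastforce
    show "no_dearer tie m z x" if "no_dearer tie m y x" "no_dearer tie m z y" for x y z
      using that linear_order_onE(2)[OF tie, of z y x] unfolding no_dearer_def by force
    show "x = y" if "no_dearer tie m y x" "no_dearer tie m x y" for x y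
      using that linear_order_onE(3)[OF tie] unfolding no_dearer_def by auto
  qed
  from theI'[OF this] show "dearest tie m A \<in> A"
    "\<And>f. f \<in> A \<Longrightarrow> no_dearer tie m f (dearest tie m A)"
    unfolding dearest_def by blast+
qed

lemma favourite:
  assumes "v \<in> C" "A \<subseteq> C" "A \<noteq> {}"
  shows "favourite \<sigma> v A \<in> A" "\<And>b. b \<in> A \<Longrightarrow> d v (favourite \<sigma> v A) \<le> d v b"
proof -
  have order: "linear_order_on C (\<sigma> v)" using profile assms(1) by (simp add: profile_on_def)
  have "\<exists>!a. a \<in> A \<and> (\<forall>b\<in>A. (a, b) \<in> \<sigma> v)"
  proof (rule finite_least)
    show "finite A" "A \<noteq> {}" using assms finite_subset[OF assms(2) finite_C] by auto
    show "(x, y) \<in> \<sigma> v \<or> (y, x) \<in> \<sigma> v" if "x \<in> A" "y \<in> A" for x y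
      using linear_order_onE(1)[OF order] that assms(2) by blast
  qed (erule linear_order_onE(2,3)[OF order], assumption)+
  note fav = theI'[OF this, folded favourite_def]
  then show "favourite \<sigma> v A \<in> A" by blast
  with fav show "d v (favourite \<sigma> v A) \<le> d v b" if "b \<in> A" for b
    using that consistent assms unfolding consistent_def by blast
qed

section \<open>Pruning\<close>

text \<open>The loop invariant \<open>Q\<close> says that no kept edge is dearer than a removed one.
  Deleting an edge of a forest creates exactly one component, so the count rises from at most
  \<open>k\<close> to \<open>k\<close> without skipping it.\<close>

lemma prune:
  assumes F: "cut_optimal \<rho> F" "num_components C F \<le> k" and "k \<le> card C"
    and m: "sound m" "F \<subseteq> known_edges m"
  shows "prune C k tie m F \<subseteq> F" "num_components C (prune C k tie m F) = k"
    and "\<And>e g. e \<in> prune C k tie m F \<Longrightarrow> g \<in> F - prune C k tie m F \<Longrightarrow> cost e \<le> cost g"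
proof -
  note FE = cut_optimal_edges[OF F(1)]
  note count = forest_card[OF finite_C forest_subset[OF cut_optimal_forest[OF F(1)]]]
  define Q where "Q P \<longleftrightarrow> P \<subseteq> F \<and> (\<forall>e\<in>P. \<forall>g\<in>F - P. cost e \<le> cost g) \<and> num_components C P \<le> k" for P
  have step: "Q (P - {dearest tie m P}) \<and> dearest tie m P \<in> P" if P: "Q P" "num_components C P \<noteq> k" for P
  proof -
    let ?e = "dearest tie m P"
    have PF: "P \<subseteq> F" and less: "num_components C P < k" using P by (auto simp: Q_def)
    have finP: "finite P" using PF FE finite_edge_set by blast
    \<comment> \<open>The empty edge set has \<open>card C\<close> components, which is at least
      \<open>k\<close>.\<close>
    have "P \<noteq> {}" using less assms(3) by (auto simp: num_components_empty)
    note e = dearest[OF subset_trans[OF PF FE] this]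
    have "num_components C (P - {?e}) = Suc (num_components C P)"
      using count[OF PF] count[OF subset_trans[OF Diff_subset PF], of "{?e}"]
        card_Suc_Diff1[OF finP e(1), of m] by linarith
    moreover have "cost f \<le> cost ?e" if "f \<in> P" for f
      using e(2)[OF that, of m] e(1)[of m] that PF m known_cost_eq[of m f] known_cost_eq[of m ?e]
      unfolding no_dearer_def by fastforce
    ultimately show ?thesis
      using P(1) less e(1)[of m] unfolding Q_def by auto
  qed
  have "Q (prune C k tie m F) \<and> num_components C (prune C k tie m F) = k"
    unfolding prune_def
  proof (rule while_rule[where P = Q and r = "measure card"])
    show "Q F" using F by (simp add: Q_def)
    show "Q (P - {dearest tie m P})" if "Q P" "num_components C P \<noteq> k" for P
      using step that by blast
    show "(P - {dearest tie m P}, P) \<in> measure card" if "Q P" "num_components C P \<noteq> k" for P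
    proof -
      have "finite P" using that(1) FE finite_edge_set[of P] unfolding Q_def by blast
      then show ?thesis using step[OF that] card_Diff1_less[of P "dearest tie m P"] by (simp del: card_Diff_insert card_Diff_singleton)
    qed
  qed auto
  then show "prune C k tie m F \<subseteq> F" "num_components C (prune C k tie m F) = k"
    "\<And>e g. e \<in> prune C k tie m F \<Longrightarrow> g \<in> F - prune C k tie m F \<Longrightarrow> cost e \<le> cost g"
    unfolding Q_def by blast+
qed

section \<open>The loop invariant\<close>

text \<open>The state does not record when an edge was chosen, so \<open>\<rho>\<close> is
  existentially quantified and extended in each round.\<close>

definition boruvka_inv :: "'a boruvka_state \<Rightarrow> bool" where
  "boruvka_inv s \<longleftrightarrow>
     supernodes s = C // connected_by (chosen s) \<and> sound (info s) \<and>
     chosen s \<subseteq> known_edges (info s) \<and> (\<exists>\<rho>. cut_optimal \<rho> (chosen s))"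

text \<open>Supernodes are equivalence classes, so at most one contains \<open>i\<close>.\<close>

lemma card_boruvka_ask:
  assumes "boruvka_inv s"
  shows "card {a. (i, a) \<in> boruvka_ask C \<sigma> s} \<le> 1"
proof -
  have "S = connected_by (chosen s) `` {i}" if "S \<in> supernodes s" "i \<in> S" for S
  proof -
    from that(1) assms obtain x where "S = connected_by (chosen s) `` {x}"
      by (auto simp: boruvka_inv_def elim: quotientE)
    with that(2) show ?thesis by (simp add: component_eq_iff)
  qed
  then have "{a. (i, a) \<in> boruvka_ask C \<sigma> s} \<subseteq> {favourite \<sigma> i (C - connected_by (chosen s) `` {i})}"
    unfolding boruvka_ask_def by blast
  then show ?thesis using card_mono[of "{favourite \<sigma> i (C - connected_by (chosen s) `` {i})}"] by fastforce
qed

text \<open>All picks consult the same costs \<open>m\<close> and receive a later round number than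
  the edges of \<open>F\<close>, which keeps the forest cut-optimal. Every supernode has its pick in
  its cut, so \<open>components_halved\<close> applies.\<close>

lemma boruvka_step:
  assumes inv: "boruvka_inv s" and many: "1 < card (supernodes s)"
  defines "s' \<equiv> boruvka_learn C tie s (answers d (boruvka_ask C \<sigma> s))"
  shows "boruvka_inv s'" "2 * card (supernodes s') \<le> card (supernodes s)"
proof -
  define V F where "V = supernodes s" and "F = chosen s"
  define m where "m = info s ++ answers d (boruvka_ask C \<sigma> s)"
  define pick where "pick S = cheapest tie m (cut C S \<inter> known_edges m)" for S
  define F' where "F' = F \<union> pick ` V"
  have V: "V = C // connected_by F" and sound: "sound (info s)" and F_known: "F \<subseteq> known_edges (info s)"
    using inv by (simp_all add: boruvka_inv_def V_def F_def)
  obtain \<rho> where \<rho>: "cut_optimal \<rho> F" using inv by (auto simp: boruvka_inv_def F_def)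
  note FE = cut_optimal_edges[OF \<rho>]
  have s': "s' = \<lparr>supernodes = contract V (F' \<inter> crossing C V), chosen = F', info = m\<rparr>"
    unfolding s'_def boruvka_learn_def Let_def F'_def pick_def m_def V_def F_def
    by (simp add: image_def Setcompr_eq_image)

  \<comment> \<open>A favourite outside \<open>S\<close> exists because of \<open>many\<close>: a
    supernode equal to \<open>C\<close> would be the only one.\<close>
  have node: "S \<subseteq> C" "F \<inter> cut C S = {}" "C - S \<noteq> {}" "S \<noteq> {}" if S: "S \<in> V" for S
  proof -
    obtain x where x: "x \<in> C" "S = connected_by F `` {x}" using S V by (auto simp: quotient_def)
    show "S \<subseteq> C" using x connected_by_closed[OF FE] by blast
    show "S \<noteq> {}" using x connected_by_refl[of x F] by blast
    show "F \<inter> cut C S = {}"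
    proof (intro equals0I, elim IntE)
      fix e assume "e \<in> F" "e \<in> cut C S"
      from this(2) obtain i j where "e = {i, j}" "i \<in> S" "j \<notin> S" by (rule cutE)
      with \<open>e \<in> F\<close> x show False
        using connected_by_trans[of x i F j] connected_by_edge[of i j F] by auto
    qed
    show "C - S \<noteq> {}"
    proof
      assume "C - S = {}"
      then have "connected_by F `` {y} = S" if "y \<in> C" for y
        using x that component_eq_iff[of F x y] by blast
      then have "V \<subseteq> {S}" using V by (auto simp: quotient_def)
      then have "card V \<le> 1" using card_mono[of "{S}" V] by simp
      then show False using many by (simp add: V_def)
    qed
  qed
  have fav: "favourite \<sigma> v (C - S) \<in> C - S" "\<And>b. b \<in> C - S \<Longrightarrow> d v (favourite \<sigma> v (C - S)) \<le> d v b"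
    if "S \<in> V" "v \<in> S" for v S
    using favourite[of v "C - S"] node[OF that(1)] that(2) by auto
  have "answers d (boruvka_ask C \<sigma> s) (v, a) = Some x \<Longrightarrow> v \<in> C \<and> a \<in> C \<and> x = d v a" for v a x
    using fav(1) node(1) unfolding answers_def boruvka_ask_def V_def
    by (fastforce split: if_splits)
  then have m: "sound m"
    using sound unfolding sound_def m_def by (auto simp: map_add_Some_iff)
  have fav_known: "{v, favourite \<sigma> v (C - S)} \<in> cut C S \<inter> known_edges m" if "S \<in> V" "v \<in> S" for v S
  proof -
    have "(v, favourite \<sigma> v (C - S)) \<in> dom m"
      using that unfolding m_def answers_def boruvka_ask_def V_def by auto
    then have "{v, favourite \<sigma> v (C - S)} \<in> known_edges m"
      unfolding known_edges_def by blast
    then show ?thesis using fav(1)[OF that] node(1)[OF that(1)] that(2) by auto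
  qed
  have pick: "pick S \<in> cut C S" "pick S \<in> known_edges m"
    "\<And>f. f \<in> cut C S \<inter> known_edges m \<Longrightarrow> no_dearer tie m (pick S) f" if "S \<in> V" for S
  proof -
    have "cut C S \<inter> known_edges m \<noteq> {}" using fav_known[OF that] node(4)[OF that] by blast
    moreover have "cut C S \<inter> known_edges m \<subseteq> edges C" using cut_subset_edges by blast
    ultimately show "pick S \<in> cut C S" "pick S \<in> known_edges m"
      "\<And>f. f \<in> cut C S \<inter> known_edges m \<Longrightarrow> no_dearer tie m (pick S) f"
      using cheapest[where A = "cut C S \<inter> known_edges m" and m = m] unfolding pick_def by simp_all
  qed
  have pick_cost: "cost (pick S) < cost f \<or> cost (pick S) = cost f \<and> (pick S, f) \<in> tie"
    if "S \<in> V" "f \<in> cut C S \<inter> known_edges m" for S f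
    using pick(2)[OF that(1)] pick(3)[OF that] that(2)
      known_cost_eq[OF m, of "pick S"] known_cost_eq[OF m, of f]
    unfolding no_dearer_def by auto
  \<comment> \<open>The pick minimises over known edges only. An arbitrary edge leaving
    \<open>S\<close> at \<open>i\<close> is no cheaper than the edge from \<open>i\<close> to its
    favourite outside \<open>S\<close>, and the cost of the latter is known.\<close>
  have pick_min: "cost (pick S) \<le> cost g" if S: "S \<in> V" and g: "g \<in> cut C S" for S g
  proof -
    obtain i j where ij: "g = {i, j}" "i \<in> C" "j \<in> C" "i \<in> S" "j \<notin> S"
      using g by (rule cutE)
    have "cost (pick S) \<le> cost {i, favourite \<sigma> i (C - S)}"
      using pick_cost[OF S fav_known[OF S ij(4)]] by linarith
    also have "\<dots> \<le> d i j" using fav[OF S ij(4)] ij by (simp add: edge_cost_eq)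
    finally show ?thesis using ij by (simp add: edge_cost_eq)
  qed

  have F'E: "F' \<subseteq> edges C" using FE pick(1) cut_subset_edges by (fastforce simp: F'_def)
  have "known_edges (info s) \<subseteq> known_edges m"
    unfolding known_edges_def m_def by auto
  then have F'_known: "F' \<subseteq> known_edges m" using F_known pick(2) by (auto simp: F'_def)
  have "finite (\<rho> ` F)" using finite_edge_set[OF FE] by simp
  \<comment> \<open>\<open>t\<close> numbers the present round; it has to exceed the numbers of all
    edges of \<open>F\<close>.\<close>
  then obtain t where t: "\<And>f. f \<in> F \<Longrightarrow> \<rho> f < t" by (auto simp: finite_nat_set_iff_bounded)
  define \<rho>' where "\<rho>' e = (if e \<in> F then \<rho> e else t)" for e
  have "cut_optimal \<rho>' F'"
    unfolding cut_optimal_def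
  proof (intro conjI ballI F'E)
    fix f assume "f \<in> F'"
    then consider "f \<in> F" | S where "S \<in> V" "f = pick S" by (auto simp: F'_def)
    then show "\<exists>S. f \<in> cut C S \<and> (\<forall>g\<in>cut C S. cost f \<le> cost g) \<and> (\<forall>g\<in>F' \<inter> cut C S. precedes \<rho>' f g)"
    proof cases
      \<comment> \<open>The cut that certified an old edge may now contain new edges. They cost at
        least as much, and in a tie the later round puts them behind.\<close>
      case 1
      then obtain S where S: "f \<in> cut C S" "\<forall>g\<in>cut C S. cost f \<le> cost g"
          "\<forall>g\<in>F \<inter> cut C S. precedes \<rho> f g"
        using \<rho> unfolding cut_optimal_def by blast
      have "precedes \<rho>' f g" if g: "g \<in> F' \<inter> cut C S" for g
      proof (cases "g \<in> F")
        case True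
        then show ?thesis using S(3) 1 g by (simp add: precedes_def \<rho>'_def)
      next
        case False
        then have "\<rho>' f < \<rho>' g" using t 1 by (simp add: \<rho>'_def)
        moreover have "cost f \<le> cost g" using S(2) g by blast
        ultimately show ?thesis by (auto simp: precedes_def)
      qed
      with S show ?thesis by blast
    next
      \<comment> \<open>No edge of \<open>F\<close> leaves a component of \<open>F\<close>, so all
        edges of \<open>F'\<close> in this cut are new. They share the round number, and cost and
        tie-breaking rule decide as in \<open>cheapest\<close>.\<close>
      case (2 S)
      have "precedes \<rho>' f g" if g: "g \<in> F' \<inter> cut C S" for g
      proof -
        have "f \<notin> F" "g \<notin> F" using node(2)[OF 2(1)] pick(1)[OF 2(1)] g 2(2) by auto
        then have "\<rho>' f = \<rho>' g" by (simp add: \<rho>'_def)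
        then show ?thesis
          using pick_cost[OF 2(1), of g] g F'_known 2(2) by (auto simp: precedes_def)
      qed
      then show ?thesis using pick(1) pick_min 2 by blast
    qed
  qed
  moreover have super: "supernodes s' = C // connected_by F'"
    unfolding s' V using contract_components[of F F' C] F'E by (simp add: F'_def)
  ultimately show "boruvka_inv s'"
    using m F'_known by (auto simp: boruvka_inv_def s')
  show "2 * card (supernodes s') \<le> card (supernodes s)"
    unfolding super using V
  proof (fold V_def, simp only:, intro components_halved finite_C F'E)
    show "F \<subseteq> F'" by (auto simp: F'_def)
    show "F' \<inter> cut C S \<noteq> {}" if "S \<in> C // connected_by F" for S
      using pick(1)[of S] that V by (auto simp: F'_def)
  qed
qed

section \<open>The complete run\<close>

text \<open>The initial list \<open>qs\<close> is arbitrary and only the appended part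
  \<open>qs'\<close> is described, so that the induction hypothesis applies after one round is
  recorded. Each round doubles the power of 2 and at least halves the number of supernodes.\<close>

lemma boruvka_terminates:
  assumes "C \<noteq> {}" "boruvka_inv s"
  shows "\<exists>s' qs'. while_option (\<lambda>(s, qs). 1 < card (supernodes s))
      (\<lambda>(s, qs). (boruvka_learn C tie s (answers d (boruvka_ask C \<sigma> s)), qs @ [boruvka_ask C \<sigma> s]))
      (s, qs) = Some (s', qs @ qs') \<and>
    boruvka_inv s' \<and> card (supernodes s') = 1 \<and> 2 ^ length qs' \<le> card (supernodes s) \<and>
    (\<forall>Q\<in>set qs'. \<forall>i. card {a. (i, a) \<in> Q} \<le> 1)"
  using assms(2)
proof (induction "card (supernodes s)" arbitrary: s qs rule: less_induct)
  case less
  have "supernodes s = C // connected_by (chosen s)" using less.prems by (simp add: boruvka_inv_def)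
  then have "supernodes s \<noteq> {}" "finite (supernodes s)"
    using assms(1) finite_components[OF finite_C] by (auto simp: quotient_def)
  then have pos: "0 < card (supernodes s)" by (simp add: card_gt_0_iff)
  show ?case
  proof (cases "1 < card (supernodes s)")
    case False
    then show ?thesis using pos less.prems by (subst while_option_unfold) auto
  next
    case True
    let ?s = "boruvka_learn C tie s (answers d (boruvka_ask C \<sigma> s))"
    note step = boruvka_step[OF less.prems True]
    have "card (supernodes ?s) < card (supernodes s)" using step(2) pos by simp
    from less.hyps[OF this step(1), of "qs @ [boruvka_ask C \<sigma> s]"] obtain s' qs' where
      run: "while_option (\<lambda>(s, qs). 1 < card (supernodes s))
        (\<lambda>(s, qs). (boruvka_learn C tie s (answers d (boruvka_ask C \<sigma> s)), qs @ [boruvka_ask C \<sigma> s]))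
        (?s, qs @ [boruvka_ask C \<sigma> s]) = Some (s', (qs @ [boruvka_ask C \<sigma> s]) @ qs')"
      and s': "boruvka_inv s'" "card (supernodes s') = 1" "2 ^ length qs' \<le> card (supernodes ?s)"
        "\<forall>Q\<in>set qs'. \<forall>i. card {a. (i, a) \<in> Q} \<le> 1"
      by blast
    have "2 ^ length (boruvka_ask C \<sigma> s # qs') \<le> card (supernodes s)"
      using s'(3) step(2) by simp
    moreover have "\<forall>Q\<in>set (boruvka_ask C \<sigma> s # qs'). \<forall>i. card {a. (i, a) \<in> Q} \<le> 1"
      using s'(4) card_boruvka_ask[OF less.prems] by simp
    moreover have "while_option (\<lambda>(s, qs). 1 < card (supernodes s))
        (\<lambda>(s, qs). (boruvka_learn C tie s (answers d (boruvka_ask C \<sigma> s)), qs @ [boruvka_ask C \<sigma> s]))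
        (s, qs) = Some (s', qs @ (boruvka_ask C \<sigma> s # qs'))"
      using run True by (subst while_option_unfold) simp
    ultimately show ?thesis using s'(1,2) by blast
  qed
qed

lemma boruvka_start: "boruvka_inv (start (boruvka C k tie \<sigma>))"
proof -
  have "{{i} | i. i \<in> C} = C // connected_by {}"
    by (auto simp: quotient_def connected_by_def)
  then show ?thesis
    by (auto simp: boruvka_def boruvka_inv_def sound_def cut_optimal_def)
qed

lemma execute_boruvka:
  assumes "1 \<le> k" "k \<le> card C"
  shows "\<exists>qs. execute (boruvka C k tie \<sigma>) d = Some (card C * min_k_forest_cost C d k, qs) \<and>
    real (per_agent_queries C qs) \<le> log 2 (card C)"
proof -
  have ne: "C \<noteq> {}" using assms by auto
  let ?M = "boruvka C k tie \<sigma>"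
  obtain s qs where run: "while_option (\<lambda>(s, qs). 1 < card (supernodes s))
      (\<lambda>(s, qs). (boruvka_learn C tie s (answers d (boruvka_ask C \<sigma> s)), qs @ [boruvka_ask C \<sigma> s]))
      (start ?M, []) = Some (s, [] @ qs)"
    and s: "boruvka_inv s" "card (supernodes s) = 1"
    and qs: "2 ^ length qs \<le> card (supernodes (start ?M))" "\<forall>Q\<in>set qs. \<forall>i. card {a. (i, a) \<in> Q} \<le> 1"
    using boruvka_terminates[OF ne boruvka_start[of k], of "[]"] by blast
  define F m where "F = chosen s" and "m = info s"
  obtain \<rho> where F: "cut_optimal \<rho> F" "num_components C F = 1" and m: "sound m" "F \<subseteq> known_edges m"
    using s by (auto simp: boruvka_inv_def num_components_def F_def m_def)
  define P where "P = prune C k tie m F"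
  \<comment> \<open>The run ends with a single component, so pruning starts from at most
    \<open>k\<close> components.\<close>
  have "num_components C F \<le> k" using F(2) assms by simp
  note P = prune[OF F(1) this assms(2) m, folded P_def]
  have "k_forest C k P"
    using forest_subset[OF cut_optimal_forest[OF F(1)] P(1)] P(2) by (simp add: k_forest_alt)
  moreover have "sum cost P \<le> sum cost G" if "k_forest C k G" for G
    using cheapest_edges_minimal[OF F P(1,3,2) that] by blast
  ultimately have "min_k_forest_cost C d k = sum cost P" by (rule min_k_forest_cost_eq)
  moreover have "(\<Sum>e\<in>P. known_cost m e) = sum cost P"
    using P(1) m by (intro sum.cong) (auto intro: known_cost_eq)
  ultimately have "estimate ?M s = card C * min_k_forest_cost C d k"
    by (simp add: boruvka_def P_def F_def m_def)
  moreover have "execute ?M d = Some (estimate ?M s, qs)"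
    using run unfolding execute_def by (simp add: boruvka_def)
  moreover have "real (per_agent_queries C qs) \<le> log 2 (card C)"
  proof -
    \<comment> \<open>One query per agent and round bounds the queries by the number of rounds,
      which is at most logarithmic because the run starts with \<open>card C\<close>
      singletons.\<close>
    have "(\<Sum>Q\<leftarrow>qs. card {a. (i, a) \<in> Q}) \<le> length qs" for i
      using qs(2) sum_list_mono[of qs "\<lambda>Q. card {a. (i, a) \<in> Q}" "\<lambda>_. 1"]
      by (simp add: sum_list_triv)
    then have "per_agent_queries C qs \<le> length qs"
      unfolding per_agent_queries_def using ne finite_C by simp
    moreover have "supernodes (start ?M) = (\<lambda>i. {i}) ` C" by (auto simp: boruvka_def)
    then have "2 ^ length qs \<le> card C" using qs(1) by (simp add: card_image)
    then have "real (length qs) \<le> log 2 (card C)" by (rule le_log2_of_power)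
    ultimately show ?thesis by linarith
  qed
  ultimately show ?thesis by simp
qed

text \<open>The upper bound collects one factor \<open>card C\<close> from
  \<open>ex_k_forest_cost_le_OPT\<close> and another from the scaling of the estimate; the lower
  bound uses a forest that attains the minimum.\<close>

lemma min_k_forest_cost_bounds:
  assumes "1 \<le> k" "k \<le> card C" "1 \<le> l"
  shows "OPT C d k l \<le> card C * min_k_forest_cost C d k"
    and "card C * min_k_forest_cost C d k \<le> (card C)\<^sup>2 * OPT C d k l"
proof -
  have ne: "C \<noteq> {}" using assms by auto
  obtain G where G: "k_forest C k G" "sum cost G \<le> card C * OPT C d k l"
    using ex_k_forest_cost_le_OPT[OF assms] by blast
  then have "min_k_forest_cost C d k \<le> sum cost G"
    unfolding min_k_forest_cost_def by (intro Min_le finite_forest_costs) auto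
  with G have "min_k_forest_cost C d k \<le> card C * OPT C d k l" by linarith
  then have "card C * min_k_forest_cost C d k \<le> card C * (card C * OPT C d k l)"
    by (intro mult_left_mono) auto
  then show "card C * min_k_forest_cost C d k \<le> (card C)\<^sup>2 * OPT C d k l"
    by (simp add: power2_eq_square mult.assoc)
  have "min_k_forest_cost C d k \<in> {sum cost F | F. k_forest C k F}"
    unfolding min_k_forest_cost_def using G by (intro Min_in finite_forest_costs) auto
  then show "OPT C d k l \<le> card C * min_k_forest_cost C d k"
    using OPT_le_forest_cost[OF ne] by auto
qed

end

theorem theorem1p1:
  shows "\<exists>q :: nat \<Rightarrow> real. q \<in> O(\<lambda>n. ln (real n)) \<and>
    (\<forall>(C :: 'a set) (d :: 'a \<Rightarrow> 'a \<Rightarrow> real) (\<sigma> :: 'a \<Rightarrow> 'a rel) (tie :: 'a set rel) (k :: nat).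
      finite C \<longrightarrow> metric_on C d \<longrightarrow> profile_on C \<sigma> \<longrightarrow> consistent C d \<sigma> \<longrightarrow>
      linear_order_on (edges C) tie \<longrightarrow> 1 \<le> k \<longrightarrow> k \<le> card C \<longrightarrow>
      (\<exists>B qs. execute (boruvka C k tie \<sigma>) d = Some (B, qs) \<and>
        real (per_agent_queries C qs) \<le> q (card C) \<and>
        B = real (card C) * min_k_forest_cost C d k \<and>
        (\<forall>l :: nat. 1 \<le> l \<longrightarrow> l \<le> card C \<longrightarrow>
          OPT C d k l \<le> B \<and> B \<le> (real (card C))\<^sup>2 * OPT C d k l)))"
\<comment> \<open>Halving gives the logarithm to base 2 as an exact bound; it is 0 for a single
  agent, when no round is run.\<close>
proof (intro exI[of _ "\<lambda>n. log 2 (real n)"] conjI allI impI)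
  show "(\<lambda>n. log 2 (real n)) \<in> O(\<lambda>n. ln (real n))"
    by (simp add: log_def)
  fix C :: "'a set" and d \<sigma> tie and k :: nat
  assume input: "finite C" "metric_on C d" "profile_on C \<sigma>" "consistent C d \<sigma>"
    "linear_order_on (edges C) tie" and k: "1 \<le> k" "k \<le> card C"
  then interpret boruvka_input C d \<sigma> tie by unfold_locales
  show "\<exists>B qs. execute (boruvka C k tie \<sigma>) d = Some (B, qs) \<and>
        real (per_agent_queries C qs) \<le> log 2 (real (card C)) \<and>
        B = real (card C) * min_k_forest_cost C d k \<and>
        (\<forall>l :: nat. 1 \<le> l \<longrightarrow> l \<le> card C \<longrightarrow>
          OPT C d k l \<le> B \<and> B \<le> (real (card C))\<^sup>2 * OPT C d k l)"
    using execute_boruvka[OF k] min_k_forest_cost_bounds[OF k] by fastforce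
qed

end
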